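(* Consider lazy exploration with laziness factor $\delta\in(0,1)$, and assume that $G_n$ is almost surely connected. Then, for any fixed $n$, almost surely $\mu_n^{(k,\mathrm{lazy})}$ converges weakly to $\mu_n^{(\infty)}$ as $k\to\infty$, where $$\mu_n^{(\infty)}=\frac1n\sum_{i\in[n]}\delta_{\Delta_{i,n}^{(\mathrm{st})}},\qquad \Delta_{i,n}^{(\mathrm{st})}=\sum_{j\in[n]}\pi_n(j)\,d_j^{(G_n)}-d_i^{(G_n)},\qquad \pi_n(j)=\frac{d_j^{(G_n)}}{\sum_{l\in[n]}d_l^{(G_n)}}.$$ Moreover, if $((d_i^{(G_n)})^2)_{i\in[n],\,n\ge2}$ is uniformly integrable and $G_n$ converges locally in probability as $n\to\infty$ to $(G_\infty,\phi)$ with a deterministic law $\bar\Lambda$, then $\mu_n^{(\infty)}$ converges weakly to $\mu$ in probability as $n\to\infty$, where $\mu$ is the law of $$\Delta_\phi=\frac{m^{(2)}}{m^{(1)}}-d_\phi,\qquad m^{(1)}=\mathbb E_{\bar\Lambda}[d_\phi],\quad m^{(2)}=\mathbb E_{\bar\Lambda}[d_\phi^2],$$ with $d_\phi$ the degree of the root $\phi$ in $G_\infty$.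
   Context: Graphs are undirected, simple or multi-graphs; $A^{(G)}_{i,j}$ is the number of edges connecting $i,j$ and $d_i^{(G)}$ the degree of $i$ in $G$. $G_n$ ($n\ge2$) is a random graph with vertex set $[n]=\{1,\dots,n\}$, without self-loops and isolated vertices. Lazy exploration with laziness factor $\delta\in(0,1)$: at each step the random walk on $G_n$ stays put with probability $\delta$ and with probability $1-\delta$ performs a step of the backtracking random walk, whose transition matrix is $P_n(i,j)=A^{(G_n)}_{i,j}/d_i^{(G_n)}$. Thus its $k$-step transition matrix is $P_n^{(k,\mathrm{lazy})}=(\delta I_n+(1-\delta)P_n)^k$. Set $\Delta_{i,n}^{(k,\mathrm{lazy})}=\sum_{j\in[n]}P_n^{(k,\mathrm{lazy})}(i,j)\,d_j^{(G_n)}-d_i^{(G_n)}$ and $\mu_n^{(k,\mathrm{lazy})}=\frac1n\sum_{i\in[n]}\delta_{\Delta_{i,n}^{(k,\mathrm{lazy})}}$ (a random measure; $\delta_x$ with a subscript is the Dirac measure at $x$). $(G_\infty,\phi)$ is an almost surely locally finite non-trivial (more than one vertex) rooted random tree with law $\bar\Lambda$. "Deterministic law" means $\bar\Lambda$ is a fixed (non-random) probability measure; $\mathbb E_{\bar\Lambda}$ is its expectation. Local convergence in probability. For a rooted graph $(H,o)$, $B_r^{(H)}(o)$ is the rooted subgraph with root $o$ whose vertices are those at graph distance $\le r$ from $o$ and whose edges are all edges of $H$ between such vertices. $\mathscr G$ is the set of connected locally finite rooted graphs, up to rooted isomorphism, with metric $\mathrm d_{\mathscr G}((H_1,o_1),(H_2,o_2))=\big(1+\sup\{r\ge0: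 B_r^{(H_1)}(o_1)\simeq B_r^{(H_2)}(o_2)\}\big)^{-1}$. $\mathscr C(G_n,i)$ is the connected component of $i$ in $G_n$, rooted at $i$. $G_n$ converges locally in probability to $(G_\infty,\phi)$ if $\frac1n\sum_{i\in[n]}h(\mathscr C(G_n,i))\to\mathbb E_{\bar\Lambda}[h((G_\infty,\phi))]$ in probability for every bounded continuous $h:\mathscr G\to\mathbb R$. A family of non-negative random variables (possibly on different probability spaces) is uniformly integrable if $\sup \mathbb E[X\mathbf 1_{\{X>M\}}]\to0$ as $M\to\infty$, the supremum being over the family. Weak convergence in probability of random measures $\nu_n$ to $\nu$ means $\int f\,d\nu_n\to\int f\,d\nu$ in probability for every bounded continuous $f:\mathbb R\to\mathbb R$. *)

theory Defs
  imports "HOL-Probability.Probability" "Jordan_Normal_Form.Matrix"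
begin

section \<open>Multigraphs\<close>

text \<open>
  An undirected multigraph is given by its vertices and its edge multiplicities:
  \<open>mult H u v\<close> is the number of edges joining \<open>u\<close> and \<open>v\<close>, and \<open>mult H v v\<close> is the number
  of loops at \<open>v\<close>. Connected locally finite graphs are countable, so up to isomorphism no
  graph is lost by taking the vertices to be natural numbers.
\<close>

record mgraph =
  verts :: "nat set"
  mult :: "nat \<Rightarrow> nat \<Rightarrow> nat"

definition wf_mgraph :: "mgraph \<Rightarrow> bool" where
  "wf_mgraph H \<longleftrightarrow>
     (\<forall>u v. mult H u v = mult H v u) \<and> (\<forall>u v. mult H u v > 0 \<longrightarrow> u \<in> verts H)"

definition adj :: "mgraph \<Rightarrow> nat rel" where
  "adj H = {(u, v). mult H u v > 0}"

definition deg :: "mgraph \<Rightarrow> nat \<Rightarrow> nat" where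
  \<comment> \<open>a loop contributes 2 to the degree\<close>
  "deg H v = (\<Sum>u | mult H v u > 0. mult H v u) + mult H v v"

definition locally_finite :: "mgraph \<Rightarrow> bool" where
  "locally_finite H \<longleftrightarrow> (\<forall>v\<in>verts H. finite {u. mult H v u > 0})"

definition mg_connected :: "mgraph \<Rightarrow> bool" where
  "mg_connected H \<longleftrightarrow> (\<forall>u\<in>verts H. \<forall>v\<in>verts H. (u, v) \<in> (adj H)\<^sup>*)"

definition gdist :: "mgraph \<Rightarrow> nat \<Rightarrow> nat \<Rightarrow> enat" where
  "gdist H u v = (INF k\<in>{k. (u, v) \<in> adj H ^^ k}. enat k)"

definition induced :: "mgraph \<Rightarrow> nat set \<Rightarrow> mgraph" where
  "induced H S = \<lparr>verts = verts H \<inter> S, mult = (\<lambda>u v. if u \<in> S \<and> v \<in> S then mult H u v else 0)\<rparr>"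

definition is_cycle :: "mgraph \<Rightarrow> nat list \<Rightarrow> bool" where
  "is_cycle H vs \<longleftrightarrow> 3 \<le> length vs \<and> distinct vs \<and>
     (\<forall>i<length vs. (vs ! i, vs ! (Suc i mod length vs)) \<in> adj H)"

text \<open>Loops and multiple edges are cycles of length 1 and 2 of a multigraph.\<close>

definition is_tree :: "mgraph \<Rightarrow> bool" where
  "is_tree H \<longleftrightarrow> mg_connected H \<and> (\<forall>v. mult H v v = 0) \<and> (\<forall>u v. mult H u v \<le> 1) \<and>
     (\<nexists>vs. is_cycle H vs)"

section \<open>The metric space of rooted graphs\<close>

text \<open>A rooted graph is a pair of a graph and its root.\<close>

definition conn_lf_rooted :: "mgraph \<times> nat \<Rightarrow> bool" where
  "conn_lf_rooted X \<longleftrightarrow> wf_mgraph (fst X) \<and> snd X \<in> verts (fst X) \<and>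
     mg_connected (fst X) \<and> locally_finite (fst X)"

definition rooted_iso_by :: "(nat \<Rightarrow> nat) \<Rightarrow> mgraph \<times> nat \<Rightarrow> mgraph \<times> nat \<Rightarrow> bool" where
  "rooted_iso_by f X Y \<longleftrightarrow> bij_betw f (verts (fst X)) (verts (fst Y)) \<and> f (snd X) = snd Y \<and>
     (\<forall>u\<in>verts (fst X). \<forall>v\<in>verts (fst X). mult (fst Y) (f u) (f v) = mult (fst X) u v)"

definition rooted_iso :: "mgraph \<times> nat \<Rightarrow> mgraph \<times> nat \<Rightarrow> bool" where
  "rooted_iso X Y \<longleftrightarrow> (\<exists>f. rooted_iso_by f X Y)"

definition root_ball :: "nat \<Rightarrow> mgraph \<times> nat \<Rightarrow> mgraph \<times> nat" where
  "root_ball r X = (induced (fst X) {v. gdist (fst X) (snd X) v \<le> enat r}, snd X)"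

text \<open>In \<^typ>\<open>ennreal\<close> we have \<open>inverse top = 0\<close> and \<open>Sup {} = 0\<close>; the latter is only needed
  if the roots carry different numbers of loops.\<close>

definition local_dist :: "mgraph \<times> nat \<Rightarrow> mgraph \<times> nat \<Rightarrow> real" where
  "local_dist X Y =
     enn2real (inverse (1 + (SUP r\<in>{r. rooted_iso (root_ball r X) (root_ball r Y)}. of_nat r)))"

subsection \<open>Isomorphism invariance\<close>

lemma adj_sym: "wf_mgraph H \<Longrightarrow> (u, v) \<in> adj H \<Longrightarrow> (v, u) \<in> adj H"
  by (auto simp: adj_def wf_mgraph_def)

lemma adj_verts: "wf_mgraph H \<Longrightarrow> (u, v) \<in> adj H \<Longrightarrow> u \<in> verts H \<and> v \<in> verts H"
  by (metis (mono_tags, lifting) adj_def case_prodD mem_Collect_eq wf_mgraph_def)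

lemma relpow_adj_verts:
  "wf_mgraph H \<Longrightarrow> u \<in> verts H \<Longrightarrow> (u, v) \<in> adj H ^^ k \<Longrightarrow> v \<in> verts H"
  by (cases k) (auto dest: adj_verts)

lemma gdist_le_iff: "gdist H u v \<le> enat r \<longleftrightarrow> (\<exists>k\<le>r. (u, v) \<in> adj H ^^ k)"
proof
  assume le: "gdist H u v \<le> enat r"
  let ?K = "enat ` {k. (u, v) \<in> adj H ^^ k}"
  have "?K \<noteq> {}"
  proof
    assume "?K = {}"
    with le show False by (simp add: gdist_def Inf_enat_def del: image_is_empty)
  qed
  then obtain x where "x \<in> ?K" by blast
  hence "Inf ?K \<in> ?K" by (rule wellorder_InfI)
  then obtain k where "Inf ?K = enat k" "(u, v) \<in> adj H ^^ k" by blast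
  with le show "\<exists>k\<le>r. (u, v) \<in> adj H ^^ k" unfolding gdist_def by auto
next
  assume "\<exists>k\<le>r. (u, v) \<in> adj H ^^ k"
  then obtain k where k: "k \<le> r" "(u, v) \<in> adj H ^^ k" by blast
  have "gdist H u v \<le> enat k" unfolding gdist_def using k(2) by (intro INF_lower) simp
  also have "\<dots> \<le> enat r" using k(1) by simp
  finally show "gdist H u v \<le> enat r" .
qed

lemma rooted_iso_by_id: "rooted_iso_by id X X"
  by (auto simp: rooted_iso_by_def)

lemma rooted_iso_by_comp:
  "rooted_iso_by f X Y \<Longrightarrow> rooted_iso_by g Y Z \<Longrightarrow> rooted_iso_by (g \<circ> f) X Z"
  unfolding rooted_iso_by_def by (auto intro: bij_betw_trans dest: bij_betwE)

lemma rooted_iso_by_inv: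
  assumes "rooted_iso_by f X Y" "snd X \<in> verts (fst X)"
  shows "rooted_iso_by (inv_into (verts (fst X)) f) Y X"
proof -
  let ?V = "verts (fst X)" and ?W = "verts (fst Y)"
  let ?g = "inv_into ?V f"
  have b: "bij_betw f ?V ?W" and r: "f (snd X) = snd Y" using assms by (auto simp: rooted_iso_by_def)
  have g: "bij_betw ?g ?W ?V" by (rule bij_betw_inv_into[OF b])
  have fg: "f (?g w) = w" "?g w \<in> ?V" if "w \<in> ?W" for w
    using that b g by (auto simp: bij_betw_inv_into_right dest: bij_betwE)
  have "?g (snd Y) = snd X" using r b assms(2) by (metis bij_betw_inv_into_left)
  moreover have "mult (fst X) (?g u) (?g v) = mult (fst Y) u v" if "u \<in> ?W" "v \<in> ?W" for u v
    using assms(1) fg that unfolding rooted_iso_by_def by metis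
  ultimately show ?thesis using g by (auto simp: rooted_iso_by_def)
qed

lemma rooted_iso_refl: "rooted_iso X X"
  unfolding rooted_iso_def using rooted_iso_by_id by blast

lemma rooted_iso_sym: "rooted_iso X Y \<Longrightarrow> snd X \<in> verts (fst X) \<Longrightarrow> rooted_iso Y X"
  unfolding rooted_iso_def using rooted_iso_by_inv by blast

lemma rooted_iso_trans: "rooted_iso X Y \<Longrightarrow> rooted_iso Y Z \<Longrightarrow> rooted_iso X Z"
  unfolding rooted_iso_def using rooted_iso_by_comp by blast

lemma rooted_iso_by_adj:
  assumes "rooted_iso_by f X Y" "u \<in> verts (fst X)" "v \<in> verts (fst X)"
  shows "(f u, f v) \<in> adj (fst Y) \<longleftrightarrow> (u, v) \<in> adj (fst X)"
  using assms by (auto simp: rooted_iso_by_def adj_def)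

lemma rooted_iso_by_relpow:
  assumes f: "rooted_iso_by f X Y" and wf: "wf_mgraph (fst X)" "wf_mgraph (fst Y)"
    and u: "u \<in> verts (fst X)" and v: "v \<in> verts (fst X)"
  shows "(f u, f v) \<in> adj (fst Y) ^^ k \<longleftrightarrow> (u, v) \<in> adj (fst X) ^^ k"
  using v
proof (induction k arbitrary: v)
  case 0
  have "inj_on f (verts (fst X))" using f by (auto simp: rooted_iso_by_def bij_betw_def)
  with 0 u show ?case by (auto dest: inj_onD)
next
  case (Suc k)
  have img: "f ` verts (fst X) = verts (fst Y)" using f by (auto simp: rooted_iso_by_def bij_betw_def)
  show ?case
  proof
    assume "(f u, f v) \<in> adj (fst Y) ^^ Suc k"
    then obtain y where y: "(f u, y) \<in> adj (fst Y) ^^ k" "(y, f v) \<in> adj (fst Y)" by auto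
    hence "y \<in> verts (fst Y)" using adj_verts wf by blast
    then obtain x where x: "x \<in> verts (fst X)" "y = f x" using img by auto
    show "(u, v) \<in> adj (fst X) ^^ Suc k"
      using Suc.IH[OF x(1)] y x rooted_iso_by_adj[OF f x(1) Suc.prems] by auto
  next
    assume "(u, v) \<in> adj (fst X) ^^ Suc k"
    then obtain x where x: "(u, x) \<in> adj (fst X) ^^ k" "(x, v) \<in> adj (fst X)" by auto
    hence "x \<in> verts (fst X)" using adj_verts wf by blast
    thus "(f u, f v) \<in> adj (fst Y) ^^ Suc k"
      using Suc.IH x rooted_iso_by_adj[OF f _ Suc.prems] by auto
  qed
qed

lemma rooted_iso_by_gdist:
  assumes "rooted_iso_by f X Y" "wf_mgraph (fst X)" "wf_mgraph (fst Y)"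
    "u \<in> verts (fst X)" "v \<in> verts (fst X)"
  shows "gdist (fst Y) (f u) (f v) = gdist (fst X) u v"
  using rooted_iso_by_relpow[OF assms] by (simp add: gdist_def)

lemma rooted_iso_by_ball:
  assumes f: "rooted_iso_by f X Y" and wf: "wf_mgraph (fst X)" "wf_mgraph (fst Y)"
    and o: "snd X \<in> verts (fst X)"
  shows "rooted_iso_by f (root_ball r X) (root_ball r Y)"
proof -
  have bij: "bij_betw f (verts (fst X)) (verts (fst Y))" and r: "f (snd X) = snd Y"
    using f by (auto simp: rooted_iso_by_def)
  have d: "gdist (fst Y) (snd Y) (f v) = gdist (fst X) (snd X) v" if "v \<in> verts (fst X)" for v
    using rooted_iso_by_gdist[OF f wf o that] r by simp
  let ?B = "verts (fst X) \<inter> {v. gdist (fst X) (snd X) v \<le> enat r}"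
  let ?C = "verts (fst Y) \<inter> {v. gdist (fst Y) (snd Y) v \<le> enat r}"
  have "bij_betw f ?B ?C"
  proof (rule bij_betwI')
    show "\<And>x y. x \<in> ?B \<Longrightarrow> y \<in> ?B \<Longrightarrow> (f x = f y) = (x = y)"
      using bij by (auto simp: bij_betw_def dest: inj_onD)
    show "\<And>x. x \<in> ?B \<Longrightarrow> f x \<in> ?C" using bij d by (auto dest: bij_betwE)
    show "\<exists>x\<in>?B. y = f x" if "y \<in> ?C" for y
    proof -
      have "y \<in> f ` verts (fst X)" using that bij by (simp add: bij_betw_def)
      then obtain x where x: "x \<in> verts (fst X)" "y = f x" by blast
      with d[OF x(1)] that show ?thesis by auto
    qed
  qed
  thus ?thesis using f r d by (auto simp: rooted_iso_by_def root_ball_def induced_def)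
qed

lemma wf_induced: "wf_mgraph H \<Longrightarrow> wf_mgraph (induced H S)"
  by (auto simp: wf_mgraph_def induced_def split: if_splits)

lemma wf_root_ball: "wf_mgraph (fst X) \<Longrightarrow> wf_mgraph (fst (root_ball r X))"
  by (simp add: root_ball_def wf_induced)

lemma root_in_ball:
  "snd X \<in> verts (fst X) \<Longrightarrow> snd (root_ball r X) \<in> verts (fst (root_ball r X))"
  by (auto simp: root_ball_def induced_def gdist_le_iff intro!: exI[of _ 0])

lemma root_ball_root_ball:
  assumes "s \<le> r"
  shows "root_ball s (root_ball r X) = root_ball s X"
proof -
  obtain H z where X: "X = (H, z)" by (cases X)
  let ?B = "induced H {v. gdist H z v \<le> enat r}"
  have sub: "adj ?B \<subseteq> adj H" by (auto simp: adj_def induced_def split: if_splits)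
  have "(z, v) \<in> adj H ^^ k \<Longrightarrow> k \<le> r \<Longrightarrow> (z, v) \<in> adj ?B ^^ k" for k v
  proof (induction k arbitrary: v)
    case (Suc k)
    then obtain w where w: "(z, w) \<in> adj H ^^ k" "(w, v) \<in> adj H" by auto
    have "gdist H z w \<le> enat r" unfolding gdist_le_iff using w(1) Suc.prems(2) Suc_leD by blast
    moreover have "gdist H z v \<le> enat r" unfolding gdist_le_iff using Suc.prems by blast
    ultimately have "(w, v) \<in> adj ?B" using w by (auto simp: adj_def induced_def)
    thus ?case using Suc w by auto
  qed auto
  moreover have "(z, v) \<in> adj ?B ^^ k \<Longrightarrow> (z, v) \<in> adj H ^^ k" for k v
    using sub by (induction k arbitrary: v) auto
  ultimately have *: "gdist ?B z v \<le> enat s \<longleftrightarrow> gdist H z v \<le> enat s" for v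
    unfolding gdist_le_iff using assms by (meson le_trans)
  have "gdist H z v \<le> enat r" if "gdist H z v \<le> enat s" for v
    using that assms by (meson enat_ord_simps(1) order_trans)
  moreover have "{v. gdist ?B z v \<le> enat s} = {v. gdist H z v \<le> enat s}" using * by blast
  moreover have "induced ?B {v. gdist H z v \<le> enat s} = induced H {v. gdist H z v \<le> enat s}"
    using calculation(1) by (auto simp: induced_def fun_eq_iff)
  ultimately show ?thesis by (simp add: X root_ball_def)
qed

lemma rooted_iso_ball_mono:
  assumes "wf_mgraph (fst X)" "wf_mgraph (fst Y)" "snd X \<in> verts (fst X)"
    and "rooted_iso (root_ball r X) (root_ball r Y)" "s \<le> r"
  shows "rooted_iso (root_ball s X) (root_ball s Y)"
proof -
  obtain f where "rooted_iso_by f (root_ball r X) (root_ball r Y)"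
    using assms(4) unfolding rooted_iso_def by blast
  from rooted_iso_by_ball[OF this, of s] show ?thesis
    using assms(1-3,5) unfolding rooted_iso_def
    by (auto simp: root_ball_root_ball wf_root_ball root_in_ball)
qed

lemma rooted_iso_by_deg:
  assumes f: "rooted_iso_by f X Y" and wf: "wf_mgraph (fst X)" "wf_mgraph (fst Y)"
    and v: "v \<in> verts (fst X)"
  shows "deg (fst Y) (f v) = deg (fst X) v"
proof -
  have b: "bij_betw f (verts (fst X)) (verts (fst Y))"
    and m: "\<And>u w. u \<in> verts (fst X) \<Longrightarrow> w \<in> verts (fst X) \<Longrightarrow> mult (fst Y) (f u) (f w) = mult (fst X) u w"
    using f by (auto simp: rooted_iso_by_def)
  have sub: "{u. mult (fst X) v u > 0} \<subseteq> verts (fst X)" using wf unfolding wf_mgraph_def by (metis (lifting) mem_Collect_eq subsetI)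
  have suby: "u \<in> verts (fst Y)" if "mult (fst Y) (f v) u > 0" for u using wf(2) that unfolding wf_mgraph_def by metis
  have "bij_betw f {u. mult (fst X) v u > 0} {u. mult (fst Y) (f v) u > 0}"
  proof (rule bij_betwI')
    show "(f x = f y) = (x = y)" if "x \<in> {u. mult (fst X) v u > 0}" "y \<in> {u. mult (fst X) v u > 0}" for x y
      using sub that b by (auto simp: bij_betw_def dest: inj_onD)
    show "f x \<in> {u. mult (fst Y) (f v) u > 0}" if "x \<in> {u. mult (fst X) v u > 0}" for x
      using that sub m[OF v] by auto
    show "\<exists>x\<in>{u. mult (fst X) v u > 0}. y = f x" if "y \<in> {u. mult (fst Y) (f v) u > 0}" for y
    proof -
      have "y \<in> f ` verts (fst X)" using that suby b by (simp add: bij_betw_def)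
      then obtain x where "x \<in> verts (fst X)" "y = f x" by blast
      with that m[OF v] show ?thesis by auto
    qed
  qed
  hence "(\<Sum>u | mult (fst Y) (f v) u > 0. mult (fst Y) (f v) u)
      = (\<Sum>u | mult (fst X) v u > 0. mult (fst Y) (f v) (f u))"
    by (rule sum.reindex_bij_betw[symmetric])
  also have "\<dots> = (\<Sum>u | mult (fst X) v u > 0. mult (fst X) v u)"
    using sub m[OF v] by (intro sum.cong) auto
  finally show ?thesis using m[OF v v] by (simp add: deg_def)
qed

lemma rooted_iso_by_tree:
  assumes f: "rooted_iso_by f X Y" and wf: "wf_mgraph (fst X)" "wf_mgraph (fst Y)"
    and c: "mg_connected (fst Y)" and t: "is_tree (fst X)"
    and z: "snd X \<in> verts (fst X)"
  shows "is_tree (fst Y)"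
proof -
  define g where "g = inv_into (verts (fst X)) f"
  have g: "rooted_iso_by g Y X" unfolding g_def by (rule rooted_iso_by_inv[OF f z])
  have bij: "bij_betw g (verts (fst Y)) (verts (fst X))" using g by (auto simp: rooted_iso_by_def)
  have out: "mult (fst Y) u v = 0" if "u \<notin> verts (fst Y) \<or> v \<notin> verts (fst Y)" for u v
    using wf(2) that unfolding wf_mgraph_def by (metis not_gr_zero)
  have "mult (fst Y) u v = (if u \<in> verts (fst Y) \<and> v \<in> verts (fst Y) then mult (fst X) (g u) (g v) else 0)" for u v
    using g out by (auto simp: rooted_iso_by_def)
  hence "(\<forall>v. mult (fst Y) v v = 0) \<and> (\<forall>u v. mult (fst Y) u v \<le> 1)"
    using t by (simp add: is_tree_def)
  moreover have "\<not> is_cycle (fst Y) vs" for vs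
  proof
    assume cy: "is_cycle (fst Y) vs"
    have vs: "set vs \<subseteq> verts (fst Y)"
    proof
      fix x assume "x \<in> set vs"
      then obtain i where "i < length vs" "x = vs ! i" by (auto simp: in_set_conv_nth)
      thus "x \<in> verts (fst Y)" using cy adj_verts[OF wf(2)] by (auto simp: is_cycle_def)
    qed
    have "is_cycle (fst X) (map g vs)"
      unfolding is_cycle_def
    proof (intro conjI allI impI)
      show "3 \<le> length (map g vs)" using cy by (simp add: is_cycle_def)
      show "distinct (map g vs)" using cy vs bij
        by (auto simp: is_cycle_def distinct_map bij_betw_def intro: inj_on_subset)
      fix i assume "i < length (map g vs)"
      hence i: "i < length vs" "Suc i mod length vs < length vs" by (auto intro: mod_less_divisor)
      hence "(vs ! i, vs ! (Suc i mod length vs)) \<in> adj (fst Y)" using cy by (auto simp: is_cycle_def)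
      thus "(map g vs ! i, map g vs ! (Suc i mod length (map g vs))) \<in> adj (fst X)"
        using i vs rooted_iso_by_adj[OF g, of "vs ! i" "vs ! (Suc i mod length vs)"]
        by (auto dest: nth_mem)
    qed
    thus False using t by (auto simp: is_tree_def)
  qed
  ultimately show ?thesis using c by (auto simp: is_tree_def)
qed

subsection \<open>Compactness: graphs with isomorphic balls of all radii are isomorphic\<close>

lemma finite_root_ball:
  assumes "conn_lf_rooted X"
  shows "finite (verts (fst (root_ball r X)))"
proof -
  obtain H z where X: "X = (H, z)" by (cases X)
  have fin: "finite {v. (z, v) \<in> adj H ^^ k}" for k
  proof (induction k)
    case (Suc k)
    have "{v. (z, v) \<in> adj H ^^ Suc k} \<subseteq> (\<Union>w\<in>{v. (z, v) \<in> adj H ^^ k}. {v. mult H w v > 0})"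
      by (auto simp: adj_def)
    moreover have "finite (\<Union>w\<in>{v. (z, v) \<in> adj H ^^ k}. {v. mult H w v > 0})"
      using Suc assms relpow_adj_verts[of H z _ k]
      by (intro finite_UN_I) (auto simp: conn_lf_rooted_def X locally_finite_def)
    ultimately show ?case by (rule finite_subset)
  qed auto
  have "verts (fst (root_ball r X)) \<subseteq> (\<Union>k\<le>r. {v. (z, v) \<in> adj H ^^ k})"
    by (auto simp: X root_ball_def induced_def gdist_le_iff)
  moreover have "finite (\<Union>k\<le>r. {v. (z, v) \<in> adj H ^^ k})" using fin by blast
  ultimately show ?thesis by (rule finite_subset)
qed

lemma in_some_root_ball:
  assumes "conn_lf_rooted X" "v \<in> verts (fst X)"
  shows "\<exists>r. v \<in> verts (fst (root_ball r X))"
proof -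
  have "(snd X, v) \<in> (adj (fst X))\<^sup>*" using assms by (auto simp: conn_lf_rooted_def mg_connected_def)
  then obtain k where "(snd X, v) \<in> adj (fst X) ^^ k" using rtrancl_imp_relpow by blast
  thus ?thesis using assms by (auto simp: root_ball_def induced_def gdist_le_iff)
qed

lemma root_ball_verts_mono:
  "s \<le> r \<Longrightarrow> verts (fst (root_ball s X)) \<subseteq> verts (fst (root_ball r X))"
  by (auto simp: root_ball_def induced_def gdist_le_iff intro: order_trans)

lemma mult_root_ball:
  "u \<in> verts (fst (root_ball r X)) \<Longrightarrow> v \<in> verts (fst (root_ball r X)) \<Longrightarrow>
     mult (fst (root_ball r X)) u v = mult (fst X) u v"
  by (auto simp: root_ball_def induced_def)

lemma pointwise_subseq:
  fixes f :: "nat \<Rightarrow> nat \<Rightarrow> nat"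
  assumes "\<And>v. finite (F v)" "\<And>r v. f r v \<in> F v"
  obtains l \<sigma> where "strict_mono \<sigma>" "\<And>v. eventually (\<lambda>n. f (\<sigma> n) v = l v) sequentially"
proof -
  have "compactin (product_topology (\<lambda>i. euclidean) UNIV) (PiE UNIV F)"
    unfolding compactin_PiE using assms(1) by (simp add: finite_imp_compact)
  hence "compact (PiE UNIV F)" unfolding euclidean_product_topology by simp
  hence "seq_compact (PiE UNIV F)" by (rule compact_imp_seq_compact)
  moreover have "\<forall>r. f r \<in> PiE UNIV F" using assms(2) by auto
  ultimately obtain l \<sigma> where s: "strict_mono \<sigma>" "(f \<circ> \<sigma>) \<longlonglongrightarrow> l" by (rule seq_compactE) auto
  have "eventually (\<lambda>n. f (\<sigma> n) v = l v) sequentially" for v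
  proof -
    have "(\<lambda>n. (f \<circ> \<sigma>) n v) \<longlonglongrightarrow> l v"
      by (rule continuous_on_tendsto_compose[OF continuous_on_product_coordinates s(2)]) auto
    thus ?thesis by (simp add: tendsto_discrete)
  qed
  with s(1) that show ?thesis by blast
qed

lemma rooted_iso_if_balls:
  assumes X: "conn_lf_rooted X" and Y: "conn_lf_rooted Y"
    and iso: "\<And>r. rooted_iso (root_ball r X) (root_ball r Y)"
  shows "rooted_iso X Y"
proof -
  let ?B = "\<lambda>r. verts (fst (root_ball r X))" and ?C = "\<lambda>r. verts (fst (root_ball r Y))"
  obtain g where g: "\<And>r. rooted_iso_by (g r) (root_ball r X) (root_ball r Y)"
    using iso unfolding rooted_iso_def by metis
  have wf: "wf_mgraph (fst X)" "wf_mgraph (fst Y)"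
    and z: "snd X \<in> verts (fst X)" using X Y by (auto simp: conn_lf_rooted_def)
  have gs: "rooted_iso_by (g r) (root_ball s X) (root_ball s Y)" if "s \<le> r" for r s
    using rooted_iso_by_ball[OF g, of r s] that wf z
    by (simp add: wf_root_ball root_in_ball root_ball_root_ball)
  define f where "f r v = (if v \<in> ?B r then g r v else 0)" for r v
  define F where "F v = insert 0 (if v \<in> verts (fst X) then ?C (LEAST s. v \<in> ?B s) else {})" for v
  have "finite (F v)" for v using finite_root_ball[OF Y] by (auto simp: F_def)
  moreover have "f r v \<in> F v" for r v
  proof (cases "v \<in> ?B r")
    case True
    have v: "v \<in> verts (fst X)" using True by (auto simp: root_ball_def induced_def)
    have 1: "v \<in> ?B (LEAST s. v \<in> ?B s)" and 2: "(LEAST s. v \<in> ?B s) \<le> r"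
      using True LeastI[of "\<lambda>s. v \<in> ?B s"] Least_le[of "\<lambda>s. v \<in> ?B s"] by auto
    have "g r v \<in> ?C (LEAST s. v \<in> ?B s)"
      using gs[OF 2] 1 by (auto simp: rooted_iso_by_def dest: bij_betwE)
    thus ?thesis using True v by (simp add: f_def F_def)
  qed (auto simp: f_def F_def)
  ultimately obtain l \<sigma> where \<sigma>: "strict_mono \<sigma>"
    and ev: "\<And>v. eventually (\<lambda>n. f (\<sigma> n) v = l v) sequentially"
    using pointwise_subseq by blast
  have ex: "\<exists>r\<ge>s. \<forall>v\<in>?B s. l v = g r v" for s
  proof -
    have "eventually (\<lambda>n. \<forall>v\<in>?B s. f (\<sigma> n) v = l v) sequentially"
      using finite_root_ball[OF X] ev by (auto intro: eventually_ball_finite)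
    hence "eventually (\<lambda>n. n \<ge> s \<and> (\<forall>v\<in>?B s. f (\<sigma> n) v = l v)) sequentially"
      by (intro eventually_conj eventually_ge_at_top)
    from eventually_happens[OF this] obtain n where n: "\<forall>v\<in>?B s. f (\<sigma> n) v = l v" "n \<ge> s"
      by auto
    have "\<sigma> n \<ge> s" using n(2) strict_mono_imp_increasing[OF \<sigma>, of n] by linarith
    moreover have "l v = g (\<sigma> n) v" if "v \<in> ?B s" for v
      using n(1)[rule_format, OF that] subsetD[OF root_ball_verts_mono[OF \<open>\<sigma> n \<ge> s\<close>, of X] that]
      by (simp add: f_def)
    ultimately show ?thesis by blast
  qed
  have l: "rooted_iso_by l (root_ball s X) (root_ball s Y)" for s
  proof -
    obtain r where r: "r \<ge> s" "\<forall>v\<in>?B s. l v = g r v" using ex by blast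
    have "snd (root_ball s X) \<in> ?B s" using root_in_ball z by blast
    moreover have "bij_betw l (?B s) (?C s)" using gs[OF r(1)] r(2)
      by (auto simp: rooted_iso_by_def cong: bij_betw_cong)
    ultimately show ?thesis using gs[OF r(1)] r(2) by (auto simp: rooted_iso_by_def)
  qed
  have common: "\<exists>s. u \<in> ?B s \<and> v \<in> ?B s" if uv: "u \<in> verts (fst X)" "v \<in> verts (fst X)" for u v
  proof -
    have "\<exists>a. u \<in> ?B a" using in_some_root_ball[OF X uv(1)] .
    then obtain a where "u \<in> ?B a" by blast
    moreover obtain b where "v \<in> ?B b" using in_some_root_ball[OF X uv(2)] by blast
    ultimately show ?thesis using root_ball_verts_mono[of a "max a b" X] root_ball_verts_mono[of b "max a b" X]
      by (auto intro!: exI[of _ "max a b"])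
  qed
  have mem: "w \<in> verts (fst Y)" if "w \<in> ?C s" for w s using that by (auto simp: root_ball_def induced_def)
  have mem': "w \<in> verts (fst X)" if "w \<in> ?B s" for w s using that by (auto simp: root_ball_def induced_def)
  have "bij_betw l (verts (fst X)) (verts (fst Y))"
  proof (rule bij_betwI')
    fix u v assume "u \<in> verts (fst X)" "v \<in> verts (fst X)"
    then obtain s where "u \<in> ?B s" "v \<in> ?B s" using common by blast
    thus "(l u = l v) = (u = v)" using l[of s] by (auto simp: rooted_iso_by_def bij_betw_def dest: inj_onD)
  next
    fix u assume "u \<in> verts (fst X)"
    then obtain s where "u \<in> ?B s" using common by blast
    thus "l u \<in> verts (fst Y)" using l[of s] mem by (auto simp: rooted_iso_by_def dest: bij_betwE)
  next
    fix w assume "w \<in> verts (fst Y)"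
    then obtain s where "w \<in> ?C s" using in_some_root_ball[OF Y] by blast
    thus "\<exists>u\<in>verts (fst X). w = l u" using l[of s] mem' by (force simp: rooted_iso_by_def bij_betw_def)
  qed
  moreover have "l (snd X) = snd Y" using l[of 0] by (auto simp: rooted_iso_by_def root_ball_def)
  moreover have "mult (fst Y) (l u) (l v) = mult (fst X) u v"
    if uv: "u \<in> verts (fst X)" "v \<in> verts (fst X)" for u v
  proof -
    obtain s where s: "u \<in> ?B s" "v \<in> ?B s" using common uv by blast
    hence "l u \<in> ?C s" "l v \<in> ?C s" using l[of s] by (auto simp: rooted_iso_by_def dest: bij_betwE)
    thus ?thesis using s l[of s] mult_root_ball[of _ s X] mult_root_ball[of _ s Y]
      unfolding rooted_iso_by_def by metis
  qed
  ultimately have "rooted_iso_by l X Y" by (auto simp: rooted_iso_by_def)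
  thus ?thesis by (auto simp: rooted_iso_def)
qed

subsection \<open>The quotient\<close>

definition rgraph_rel :: "mgraph \<times> nat \<Rightarrow> mgraph \<times> nat \<Rightarrow> bool" where
  "rgraph_rel X Y \<longleftrightarrow> conn_lf_rooted X \<and> conn_lf_rooted Y \<and> rooted_iso X Y"

lemma part_equivp_rgraph_rel: "part_equivp rgraph_rel"
proof (rule part_equivpI)
  let ?X = "(\<lparr>verts = {0}, mult = (\<lambda>_ _. 0)\<rparr>, 0)"
  have "conn_lf_rooted ?X"
    by (auto simp: conn_lf_rooted_def wf_mgraph_def mg_connected_def locally_finite_def)
  thus "\<exists>X. rgraph_rel X X" using rooted_iso_refl by (auto simp: rgraph_rel_def)
  show "symp rgraph_rel"
    by (auto intro!: sympI rooted_iso_sym simp: rgraph_rel_def conn_lf_rooted_def)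
  show "transp rgraph_rel" by (auto intro!: transpI intro: rooted_iso_trans simp: rgraph_rel_def)
qed

quotient_type rgraph = "mgraph \<times> nat" / partial: rgraph_rel
  by (rule part_equivp_rgraph_rel)

lemma rgraph_rel_ball:
  "rgraph_rel X Y \<Longrightarrow> rooted_iso (root_ball r X) (root_ball r Y)"
  unfolding rgraph_rel_def rooted_iso_def conn_lf_rooted_def using rooted_iso_by_ball by blast

lemma local_dist_cong:
  assumes X: "rgraph_rel X X'" and Y: "rgraph_rel Y Y'"
  shows "local_dist X Y = local_dist X' Y'"
proof -
  have zz: "snd X \<in> verts (fst X)" "snd Y \<in> verts (fst Y)"
    using X Y by (auto simp: rgraph_rel_def conn_lf_rooted_def)
  have "rooted_iso (root_ball r X) (root_ball r Y) \<longleftrightarrow> rooted_iso (root_ball r X') (root_ball r Y')" for r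
    using rgraph_rel_ball[OF X, of r] rgraph_rel_ball[OF Y, of r]
      rooted_iso_sym root_in_ball[OF zz(1), of r] root_in_ball[OF zz(2), of r] rooted_iso_trans by metis
  thus ?thesis by (simp add: local_dist_def)
qed

lemma ennreal_inverse_antimono: "a \<le> b \<Longrightarrow> inverse b \<le> inverse (a :: ennreal)"
  by (simp add: less_eq_ennreal.rep_eq inverse_ennreal.rep_eq ereal_inverse_antimono)

instantiation rgraph :: metric_space
begin

lift_definition dist_rgraph :: "rgraph \<Rightarrow> rgraph \<Rightarrow> real" is local_dist
  by (rule local_dist_cong)

definition uniformity_rgraph :: "(rgraph \<times> rgraph) filter" where
  "uniformity_rgraph = (INF e\<in>{0<..}. principal {(x, y). dist x y < e})"

definition open_rgraph :: "rgraph set \<Rightarrow> bool" where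
  "open_rgraph U = (\<forall>x\<in>U. eventually (\<lambda>(x', y). x' = x \<longrightarrow> y \<in> U) uniformity)"

instance
proof
  show "uniformity = (INF e\<in>{0<..}. principal {(x, y :: rgraph). dist x y < e})"
    by (rule uniformity_rgraph_def)
  show "open U = (\<forall>x\<in>U. eventually (\<lambda>(x', y). x' = x \<longrightarrow> y \<in> U) uniformity)" for U :: "rgraph set"
    by (rule open_rgraph_def)
next
  fix x y :: rgraph
  show "(dist x y = 0) = (x = y)"
  proof transfer
    fix X Y assume "rgraph_rel X X" "rgraph_rel Y Y"
    hence X: "conn_lf_rooted X" and Y: "conn_lf_rooted Y" by (auto simp: rgraph_rel_def)
    let ?D = "{r. rooted_iso (root_ball r X) (root_ball r Y)}"
    let ?S = "SUP r\<in>?D. of_nat r :: ennreal"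
    have "rooted_iso X Y" if "local_dist X Y = 0"
    proof (rule rooted_iso_if_balls[OF X Y], rule ccontr)
      fix r assume n: "\<not> rooted_iso (root_ball r X) (root_ball r Y)"
      have "s \<le> r" if "s \<in> ?D" for s
      proof (rule ccontr)
        assume "\<not> s \<le> r"
        with n rooted_iso_ball_mono[of X Y s r] that X Y show False by (auto simp: conn_lf_rooted_def)
      qed
      hence "?S \<le> of_nat r" by (intro SUP_least) auto
      also have "\<dots> < Orderings.top" by (simp add: of_nat_less_top)
      finally have "1 + ?S < Orderings.top" by simp
      moreover have "inverse (1 + ?S) < Orderings.top" by (simp add: less_top[symmetric] ennreal_inverse_eq_top_iff)
      ultimately have "local_dist X Y > 0"
        unfolding local_dist_def by (auto simp: enn2real_positive_iff ennreal_inverse_positive less_top[symmetric])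
      with that show False by simp
    qed
    moreover have "local_dist X Y = 0" if "rooted_iso X Y"
    proof -
      have "?D = UNIV" using rgraph_rel_ball[of X Y] that X Y by (auto simp: rgraph_rel_def)
      moreover have "(SUP r. of_nat r :: ennreal) = Orderings.top" by (rule ennreal_SUP_of_nat_eq_top)
      ultimately show ?thesis by (simp only: local_dist_def) simp
    qed
    ultimately show "(local_dist X Y = 0) = rgraph_rel X Y" using X Y by (auto simp: rgraph_rel_def)
  qed
next
  fix x y z :: rgraph
  show "dist x y \<le> dist x z + dist y z"
  proof transfer
    fix X Y Z assume "rgraph_rel X X" "rgraph_rel Y Y" "rgraph_rel Z Z"
    hence X: "conn_lf_rooted X" and Y: "conn_lf_rooted Y" and Z: "conn_lf_rooted Z" by (auto simp: rgraph_rel_def)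
    define D where "D X Y = {r. rooted_iso (root_ball r X) (root_ball r Y)}" for X Y
    have anti: "inverse b \<le> inverse a" if "a \<le> b" for a b :: ennreal
      using that by (rule ennreal_inverse_antimono)
    have mono: "local_dist A B \<le> local_dist A' B'" if "D A' B' \<subseteq> D A B" for A B A' B'
      unfolding local_dist_def
      using that by (intro enn2real_mono anti add_left_mono SUP_subset_mono)
         (auto simp: D_def less_top[symmetric] ennreal_inverse_eq_top_iff)
    have down: "s \<in> D A B" if "r \<in> D A B" "s \<le> r" "conn_lf_rooted A" "conn_lf_rooted B" for A B r s
      using that rooted_iso_ball_mono[of A B r s] by (auto simp: D_def conn_lf_rooted_def)
    have tri: "D X Z \<inter> D Y Z \<subseteq> D X Y"
      using rooted_iso_trans rooted_iso_sym root_in_ball Y unfolding D_def conn_lf_rooted_def by blast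
    have "D X Z \<subseteq> D Y Z \<or> D Y Z \<subseteq> D X Z" using down X Y Z by (meson nle_le subsetI)
    hence "D X Z \<subseteq> D X Y \<or> D Y Z \<subseteq> D X Y" using tri by auto
    moreover have "local_dist A B \<ge> 0" for A B by (simp add: local_dist_def)
    ultimately show "local_dist X Y \<le> local_dist X Z + local_dist Y Z"
      using mono by (smt (verit))
  qed
qed

end

lift_definition root_deg :: "rgraph \<Rightarrow> nat" is "\<lambda>(H, z). deg H z"
proof -
  fix p q assume pq: "rgraph_rel p q"
  then obtain f where f: "rooted_iso_by f p q" by (auto simp: rgraph_rel_def rooted_iso_def)
  hence "f (snd p) = snd q" by (simp add: rooted_iso_by_def)
  moreover have "deg (fst q) (f (snd p)) = deg (fst p) (snd p)"
    using pq by (intro rooted_iso_by_deg[OF f]) (simp_all add: rgraph_rel_def conn_lf_rooted_def)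
  ultimately show "(case p of (H, z) \<Rightarrow> deg H z) = (case q of (H, z) \<Rightarrow> deg H z)"
    by (simp add: split_beta)
qed

lift_definition rooted_tree :: "rgraph \<Rightarrow> bool" is "\<lambda>(H, z). is_tree H"
proof -
  fix p q assume pq: "rgraph_rel p q"
  have *: "is_tree (fst Y)" if "rgraph_rel X Y" "is_tree (fst X)" for X Y
    using that rooted_iso_by_tree unfolding rgraph_rel_def rooted_iso_def conn_lf_rooted_def by blast
  have "rgraph_rel q p" using pq part_equivp_symp[OF part_equivp_rgraph_rel] by blast
  with *[OF pq] *[of q p] show "(case p of (H, z) \<Rightarrow> is_tree H) = (case q of (H, z) \<Rightarrow> is_tree H)"
    unfolding split_beta by blast
qed

lift_definition nontrivial :: "rgraph \<Rightarrow> bool" is "\<lambda>(H, z). \<exists>u\<in>verts H. \<exists>v\<in>verts H. u \<noteq> v"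
proof -
  fix p q assume pq: "rgraph_rel p q"
  then obtain f where "bij_betw f (verts (fst p)) (verts (fst q))"
    by (auto simp: rgraph_rel_def rooted_iso_def rooted_iso_by_def)
  hence f: "inj_on f (verts (fst p))" "verts (fst q) = f ` verts (fst p)" by (auto simp: bij_betw_def)
  thus "(case p of (H, z) \<Rightarrow> \<exists>u\<in>verts H. \<exists>v\<in>verts H. u \<noteq> v) =
    (case q of (H, z) \<Rightarrow> \<exists>u\<in>verts H. \<exists>v\<in>verts H. u \<noteq> v)"
    unfolding split_beta f(2) using f(1) by (simp add: inj_on_eq_iff cong: conj_cong bex_cong)
qed

definition component :: "mgraph \<Rightarrow> nat \<Rightarrow> rgraph" where
  "component H i = abs_rgraph (induced H {v. (i, v) \<in> (adj H)\<^sup>*}, i)"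

section \<open>Random graphs\<close>

definition graphs_on :: "nat \<Rightarrow> mgraph set" where
  "graphs_on n = {H. wf_mgraph H \<and> verts H = {1..n} \<and>
     (\<forall>i. mult H i i = 0) \<and> (\<forall>i\<in>{1..n}. deg H i > 0)}"

text \<open>Since \<^term>\<open>graphs_on n\<close> is countable, the discrete \<open>\<sigma>\<close>-algebra is the appropriate one.\<close>

definition random_graph :: "nat \<Rightarrow> 'w measure \<Rightarrow> ('w \<Rightarrow> mgraph) \<Rightarrow> bool" where
  "random_graph n M G \<longleftrightarrow> prob_space M \<and> G \<in> measurable M (count_space (graphs_on n))"

text \<open>\<^const>\<open>component\<close> is only meaningful on representatives of elements of \<^typ>\<open>rgraph\<close>.\<close>

lemma component_conn_lf_rooted:
  assumes "H \<in> graphs_on n" "i \<in> {1..n}"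
  shows "conn_lf_rooted (induced H {v. (i, v) \<in> (adj H)\<^sup>*}, i)"
proof -
  let ?S = "{v. (i, v) \<in> (adj H)\<^sup>*}"
  have wf: "wf_mgraph H" and V: "verts H = {1..n}" using assms by (auto simp: graphs_on_def)
  have adj: "adj (induced H ?S) = {(u, v) \<in> adj H. u \<in> ?S \<and> v \<in> ?S}"
    by (auto simp: adj_def induced_def)
  have to: "(i, v) \<in> (adj (induced H ?S))\<^sup>*" if "(i, v) \<in> (adj H)\<^sup>*" for v
    using that
  proof (induction rule: rtrancl_induct)
    case (step y z)
    have "(y, z) \<in> adj (induced H ?S)" unfolding adj using step by auto
    with step show ?case by auto
  qed auto
  have "sym (adj (induced H ?S))" using adj_sym[OF wf_induced[OF wf]] by (auto intro: symI)
  hence "sym ((adj (induced H ?S))\<^sup>*)" by (rule sym_rtrancl)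
  hence reach: "(u, v) \<in> (adj (induced H ?S))\<^sup>*" if "u \<in> ?S" "v \<in> ?S" for u v
  proof -
    have "(u, i) \<in> (adj (induced H ?S))\<^sup>*" using \<open>sym ((adj (induced H ?S))\<^sup>*)\<close> to that(1) by (auto dest: symD)
    moreover have "(i, v) \<in> (adj (induced H ?S))\<^sup>*" using to that(2) by simp
    ultimately show ?thesis by (rule rtrancl_trans)
  qed
  have vs: "verts (induced H ?S) = {1..n} \<inter> ?S" using V by (simp add: induced_def)
  have "mg_connected (induced H ?S)" unfolding mg_connected_def vs using reach by blast
  moreover have "locally_finite (induced H ?S)"
    unfolding locally_finite_def
  proof
    fix v
    have "u \<in> {1..n}" if "mult H v u > 0" for u
      using adj_verts[OF wf, of v u] that V by (simp add: adj_def)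
    hence "{u. 0 < mult (induced H ?S) v u} \<subseteq> {1..n}" by (auto simp: induced_def split: if_splits) 
    thus "finite {u. 0 < mult (induced H ?S) v u}" by (rule finite_subset) auto
  qed
  moreover have "i \<in> verts (induced H ?S)" using vs assms(2) by simp
  ultimately show ?thesis using wf_induced[OF wf] by (simp add: conn_lf_rooted_def)
qed

section \<open>Modes of convergence\<close>

definition unif_integrable ::
    "'i set \<Rightarrow> ('i \<Rightarrow> 'w measure) \<Rightarrow> ('i \<Rightarrow> 'w \<Rightarrow> real) \<Rightarrow> bool" where
  \<comment> \<open>for non-negative \<open>X\<close>; the \<open>X i\<close> may live on different probability spaces\<close>
  "unif_integrable I M X \<longleftrightarrow>
     ((\<lambda>K :: real. SUP i\<in>I. \<integral>\<^sup>+\<omega>. ennreal (X i \<omega> * indicator {\<omega>. X i \<omega> > K} \<omega>) \<partial>M i) \<longlongrightarrow> 0) at_top"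

definition tendsto_in_prob ::
    "(nat \<Rightarrow> 'w measure) \<Rightarrow> (nat \<Rightarrow> 'w \<Rightarrow> real) \<Rightarrow> real \<Rightarrow> bool" where
  "tendsto_in_prob M X c \<longleftrightarrow>
     (\<forall>\<epsilon>>0. (\<lambda>n. measure (M n) {\<omega> \<in> space (M n). \<bar>X n \<omega> - c\<bar> > \<epsilon>}) \<longlonglongrightarrow> 0)"

definition weak_conv_in_prob ::
    "(nat \<Rightarrow> 'w measure) \<Rightarrow> (nat \<Rightarrow> 'w \<Rightarrow> real measure) \<Rightarrow> real measure \<Rightarrow> bool" where
  "weak_conv_in_prob M \<nu> \<mu> \<longleftrightarrow>
     (\<forall>f :: real \<Rightarrow> real. continuous_on UNIV f \<longrightarrow> bounded (range f) \<longrightarrow>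
        tendsto_in_prob M (\<lambda>n \<omega>. \<integral>x. f x \<partial>\<nu> n \<omega>) (\<integral>x. f x \<partial>\<mu>))"

definition local_conv_in_prob ::
    "(nat \<Rightarrow> 'w measure) \<Rightarrow> (nat \<Rightarrow> 'w \<Rightarrow> mgraph) \<Rightarrow> rgraph measure \<Rightarrow> bool" where
  "local_conv_in_prob M G \<Lambda> \<longleftrightarrow>
     (\<forall>h :: rgraph \<Rightarrow> real. continuous_on UNIV h \<longrightarrow> bounded (range h) \<longrightarrow>
        tendsto_in_prob M (\<lambda>n \<omega>. (\<Sum>i\<in>{1..n}. h (component (G n \<omega>) i)) / real n) (\<integral>x. h x \<partial>\<Lambda>))"

section \<open>Lazy exploration and its empirical measures\<close>

definition empirical :: "nat \<Rightarrow> (nat \<Rightarrow> real) \<Rightarrow> real measure" where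
  "empirical n x = measure_of UNIV (sets borel)
     (\<lambda>B. (\<Sum>i\<in>{1..n}. emeasure (return borel (x i)) B) / of_nat n)"

lemma space_empirical [simp]: "space (empirical n x) = UNIV"
  by (simp add: empirical_def space_measure_of_conv)

lemma sets_empirical [simp, measurable_cong]: "sets (empirical n x) = sets borel"
proof -
  have "sets (empirical n x) = sigma_sets (space borel) (sets (borel :: real measure))"
    unfolding empirical_def by (subst sets_measure_of) auto
  thus ?thesis by (simp only: sets.sigma_sets_eq)
qed

lemma emeasure_empirical:
  assumes "B \<in> sets borel"
  shows "emeasure (empirical n x) B = (\<Sum>i\<in>{1..n}. emeasure (return borel (x i)) B) / of_nat n"
  unfolding empirical_def
proof (rule emeasure_measure_of_sigma)
  show "sigma_algebra UNIV (sets (borel :: real measure))"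
    by (metis sets.sigma_algebra_axioms space_borel)
  show "positive (sets borel) (\<lambda>B. (\<Sum>i\<in>{1..n}. emeasure (return borel (x i)) B) / of_nat n)"
    by (simp add: positive_def)
  show "countably_additive (sets borel) (\<lambda>B. (\<Sum>i\<in>{1..n}. emeasure (return borel (x i)) B) / of_nat n)"
  proof (rule countably_additiveI)
    fix A :: "nat \<Rightarrow> real set"
    assume A: "range A \<subseteq> sets borel" "disjoint_family A" "(\<Union>i. A i) \<in> sets borel"
    have "(\<Sum>k. emeasure (return borel (x i)) (A k)) = emeasure (return borel (x i)) (\<Union>k. A k)" for i
      using A by (intro suminf_emeasure) auto
    note * = this
    have "(\<Sum>k. (\<Sum>i\<in>{1..n}. emeasure (return borel (x i)) (A k)) / of_nat n)
       = (\<Sum>i\<in>{1..n}. \<Sum>k. emeasure (return borel (x i)) (A k)) / of_nat n"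
      by (simp add: ennreal_suminf_divide suminf_sum)
    also have "\<dots> = (\<Sum>i\<in>{1..n}. emeasure (return borel (x i)) (\<Union>k. A k)) / of_nat n"
      by (simp only: *)
    finally show "(\<Sum>k. (\<Sum>i\<in>{1..n}. emeasure (return borel (x i)) (A k)) / of_nat n)
       = (\<Sum>i\<in>{1..n}. emeasure (return borel (x i)) (\<Union> (range A))) / of_nat n" .
  qed
qed (use assms in auto)

text \<open>Matrix indices start at 0: entry \<open>(i - 1, j - 1)\<close> belongs to the vertices \<open>i\<close>, \<open>j\<close>.\<close>

definition trans_mat :: "nat \<Rightarrow> mgraph \<Rightarrow> real mat" where
  "trans_mat n H = mat n n (\<lambda>(i, j). real (mult H (i + 1) (j + 1)) / real (deg H (i + 1)))"

definition lazy_mat :: "real \<Rightarrow> nat \<Rightarrow> nat \<Rightarrow> mgraph \<Rightarrow> real mat" where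
  "lazy_mat \<delta> k n H = (\<delta> \<cdot>\<^sub>m 1\<^sub>m n + (1 - \<delta>) \<cdot>\<^sub>m trans_mat n H) ^\<^sub>m k"

definition bias_lazy :: "real \<Rightarrow> nat \<Rightarrow> nat \<Rightarrow> mgraph \<Rightarrow> nat \<Rightarrow> real" where
  "bias_lazy \<delta> k n H i =
     (\<Sum>j\<in>{1..n}. lazy_mat \<delta> k n H $$ (i - 1, j - 1) * real (deg H j)) - real (deg H i)"

definition mu_lazy :: "real \<Rightarrow> nat \<Rightarrow> nat \<Rightarrow> mgraph \<Rightarrow> real measure" where
  "mu_lazy \<delta> k n H = empirical n (bias_lazy \<delta> k n H)"

definition stat_dist :: "nat \<Rightarrow> mgraph \<Rightarrow> nat \<Rightarrow> real" where
  "stat_dist n H j = real (deg H j) / (\<Sum>l\<in>{1..n}. real (deg H l))"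

definition bias_st :: "nat \<Rightarrow> mgraph \<Rightarrow> nat \<Rightarrow> real" where
  "bias_st n H i = (\<Sum>j\<in>{1..n}. stat_dist n H j * real (deg H j)) - real (deg H i)"

definition mu_st :: "nat \<Rightarrow> mgraph \<Rightarrow> real measure" where
  "mu_st n H = empirical n (bias_st n H)"

definition limit_law :: "rgraph measure \<Rightarrow> real measure" where
  "limit_law \<Lambda> =
     (let m1 = (\<integral>x. real (root_deg x) \<partial>\<Lambda>); m2 = (\<integral>x. (real (root_deg x))\<^sup>2 \<partial>\<Lambda>)
      in distr \<Lambda> borel (\<lambda>x. m2 / m1 - real (root_deg x)))"

end

theory Submission
  imports Defs
begin

text \<open>
  The two halves of the theorem are independent of each other.

  \<^emph>\<open>Fixed graph, many steps.\<close> Averaging a function over the neighbours of a vertex is a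
  contraction for the norm weighted by the degrees, because the walk is reversible with respect
  to them. Laziness makes the contraction quantitative: one step lowers the energy
  \<open>\<Sum>i. d\<^sub>i (f i)\<^sup>2\<close> by at least a multiple of \<open>\<Sum>i j. A\<^sub>i\<^sub>j (f i - f j)\<^sup>2\<close>
  (\<open>lazy_step_energy\<close>). The energy is non-negative and so its decrements tend to 0; hence the
  iterates flatten out along every edge and, on a connected graph, everywhere. As the weighted
  mean \<open>\<Sum>i. d\<^sub>i f i\<close> is preserved (\<open>lazy_step_mass\<close>), the constant that is approached is the
  stationary mean of \<open>f\<close>. For \<open>f = d\<close> this is convergence of every bias, and weak convergence of
  the empirical measures follows because each of their finitely many atoms converges.

  \<^emph>\<open>Stationary bias, large graphs.\<close> The stationary bias of \<open>i\<close> equals \<open>S\<^sub>2 / S\<^sub>1 - d\<^sub>i\<close>, where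
  \<open>S\<^sub>1\<close> and \<open>S\<^sub>2\<close> are the averages of the degrees and of their squares. The degree of
  the root is a locally constant function on the space of rooted graphs, since it can be read off
  from the ball of radius 1. So local convergence gives at once the convergence of the average of
  every bounded function of the degree (\<open>deg_mean_bounded_tendsto\<close>). Uniform integrability of the
  squared degrees extends this by truncation to every function that is dominated by the square
  (\<open>deg_mean_tendsto\<close>), in particular to \<open>S\<^sub>1\<close> and \<open>S\<^sub>2\<close>; the limit \<open>m\<^sub>1\<close> of \<open>S\<^sub>1\<close> is at
  least 1, because the root of a non-trivial connected graph has a neighbour. Finally
  \<open>S\<^sub>2 / S\<^sub>1\<close> may be replaced by its limit inside a bounded continuous test function: on the
  vertices of bounded degree the test function is uniformly continuous, and convergence of
  \<open>S\<^sub>2\<close> limits the proportion of the other vertices.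
\<close>

section \<open>Empirical measures\<close>

text \<open>
  An empirical measure is the law of the value at a uniformly chosen index, so that the
  transfer of integrals along \<^const>\<open>distr\<close> applies to it.
\<close>

lemma empirical_eq_distr:
  assumes "n \<ge> 1"
  shows "empirical n x = distr (measure_pmf (pmf_of_set {1..n})) borel x"
proof (rule measure_eqI)
  fix B assume "B \<in> sets (empirical n x)"
  then have B: "B \<in> sets borel" by simp
  have "emeasure (empirical n x) B = (\<Sum>i\<in>{1..n}. indicator (x -` B) i) / of_nat n"
    using B by (simp add: emeasure_empirical indicator_def)
  also have "\<dots> = of_nat (card ({1..n} \<inter> x -` B)) / of_nat n"
    by (simp add: indicator_def sum.If_cases Int_def)
  also have "\<dots> = emeasure (measure_pmf (pmf_of_set {1..n})) (x -` B)"
    using assms by (subst emeasure_pmf_of_set) (auto simp: ennreal_of_nat_eq_real_of_nat divide_ennreal)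
  also have "\<dots> = emeasure (distr (measure_pmf (pmf_of_set {1..n})) borel x) B"
    using B by (simp add: emeasure_distr)
  finally show "emeasure (empirical n x) B = emeasure (distr (measure_pmf (pmf_of_set {1..n})) borel x) B" .
qed simp

lemma integral_empirical:
  fixes f :: "real \<Rightarrow> real"
  assumes "n \<ge> 1" "f \<in> borel_measurable borel"
  shows "(\<integral>y. f y \<partial>empirical n x) = (\<Sum>i\<in>{1..n}. f (x i)) / n"
  using assms by (simp add: empirical_eq_distr integral_distr integral_pmf_of_set)

lemma real_distribution_empirical: "n \<ge> 1 \<Longrightarrow> real_distribution (empirical n x)"
  by (simp add: empirical_eq_distr real_distribution_def real_distribution_axioms_def
      prob_space.prob_space_distr measure_pmf.prob_space_axioms)

lemma weak_conv_m_empirical: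
  assumes "n \<ge> 1" "\<And>i. i \<in> {1..n} \<Longrightarrow> (\<lambda>k. x k i) \<longlonglongrightarrow> y i"
  shows "weak_conv_m (\<lambda>k. empirical n (x k)) (empirical n y)"
proof (rule integral_bdd_continuous_conv_imp_weak_conv)
  fix f :: "real \<Rightarrow> real" assume f: "\<And>x. isCont f x"
  then have [measurable]: "f \<in> borel_measurable borel"
    by (simp add: borel_measurable_continuous_onI continuous_at_imp_continuous_on)
  have "(\<lambda>k. (\<Sum>i\<in>{1..n}. f (x k i)) / n) \<longlonglongrightarrow> (\<Sum>i\<in>{1..n}. f (y i)) / n"
    using assms(2) f by (intro tendsto_divide tendsto_sum isCont_tendsto_compose[OF f] tendsto_const)
      (use assms(1) in auto)
  then show "(\<lambda>k. \<integral>z. f z \<partial>empirical n (x k)) \<longlonglongrightarrow> (\<integral>z. f z \<partial>empirical n y)"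
    using assms(1) by (simp add: integral_empirical)
qed (use assms in \<open>auto intro: real_distribution_empirical\<close>)

section \<open>Convergence of the lazy walk on a fixed connected graph\<close>

lemma deg_eq_sum_mult:
  assumes "H \<in> graphs_on n"
  shows "deg H i = (\<Sum>j\<in>{1..n}. mult H i j)"
proof -
  have "j \<in> {1..n}" if "mult H i j > 0" for j
    using that adj_verts[of H i j] assms by (auto simp: graphs_on_def adj_def)
  then have "(\<Sum>u | mult H i u > 0. mult H i u) = (\<Sum>j\<in>{1..n}. mult H i j)"
    by (intro sum.mono_neutral_left) auto
  then show ?thesis using assms by (simp add: deg_def graphs_on_def)
qed

text \<open>
  The transition matrix acting on a function of the vertices. Working with this operator instead
  of matrix powers avoids index shifts and the dimension of the matrix.
\<close>

definition lazy_step :: "real \<Rightarrow> nat \<Rightarrow> mgraph \<Rightarrow> (nat \<Rightarrow> real) \<Rightarrow> nat \<Rightarrow> real" where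
  "lazy_step \<delta> n H f i = \<delta> * f i + (1 - \<delta>) * (\<Sum>j\<in>{1..n}. mult H i j / deg H i * f j)"

lemma lazy_mat_eq_lazy_step:
  assumes "i \<in> {1..n}"
  shows "(\<Sum>j\<in>{1..n}. lazy_mat \<delta> k n H $$ (i - 1, j - 1) * f j) = (lazy_step \<delta> n H ^^ k) f i"
proof -
  define L where "L = \<delta> \<cdot>\<^sub>m 1\<^sub>m n + (1 - \<delta>) \<cdot>\<^sub>m trans_mat n H"
  have L: "L \<in> carrier_mat n n" by (simp add: L_def trans_mat_def)
  have shift: "(\<Sum>j\<in>{1..n}. g (j - 1) * f j) = (\<Sum>j<n. g j * f (Suc j))" for f g :: "nat \<Rightarrow> real"
    by (rule sum.reindex_bij_witness[of _ Suc "\<lambda>j. j - 1"]) auto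
  have shift': "(\<Sum>j<n. f (Suc j)) = (\<Sum>j\<in>{1..n}. f j)" for f :: "nat \<Rightarrow> real"
    by (rule sum.reindex_bij_witness[of _ "\<lambda>j. j - 1" Suc]) auto
  have step: "(\<Sum>j<n. L $$ (l, j) * f (Suc j)) = lazy_step \<delta> n H f (Suc l)" if "l < n" for f l
  proof -
    have "(\<Sum>j<n. L $$ (l, j) * f (Suc j))
        = (\<Sum>j<n. (if j = l then \<delta> * f (Suc j) else 0)
            + (1 - \<delta>) * (mult H (Suc l) (Suc j) / deg H (Suc l) * f (Suc j)))"
      using that by (intro sum.cong) (auto simp: L_def trans_mat_def algebra_simps)
    also have "\<dots> = lazy_step \<delta> n H f (Suc l)"
      using that shift'[of "\<lambda>j. (1 - \<delta>) * (mult H (Suc l) j / deg H (Suc l) * f j)"]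
      by (simp add: sum.distrib lazy_step_def sum_distrib_left)
    finally show ?thesis .
  qed
  have "(\<Sum>j<n. (L ^\<^sub>m k) $$ (l, j) * f (Suc j)) = (lazy_step \<delta> n H ^^ k) f (Suc l)" if "l < n" for l
  proof (induction k arbitrary: f)
    case 0
    have "(\<Sum>j<n. (L ^\<^sub>m 0) $$ (l, j) * f (Suc j)) = (\<Sum>j<n. if j = l then f (Suc j) else 0)"
      using that L by (intro sum.cong) auto
    then show ?case using that by simp
  next
    case (Suc k)
    have Lk: "L ^\<^sub>m k \<in> carrier_mat n n" using L by simp
    have "(\<Sum>j<n. (L ^\<^sub>m Suc k) $$ (l, j) * f (Suc j))
        = (\<Sum>j<n. (\<Sum>m<n. (L ^\<^sub>m k) $$ (l, m) * L $$ (m, j)) * f (Suc j))"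
      using that L Lk by (intro sum.cong) (auto simp: scalar_prod_def atLeast0LessThan)
    also have "\<dots> = (\<Sum>m<n. (L ^\<^sub>m k) $$ (l, m) * (\<Sum>j<n. L $$ (m, j) * f (Suc j)))"
      by (simp add: sum_distrib_left sum_distrib_right mult.assoc) (rule sum.swap)
    also have "\<dots> = (\<Sum>m<n. (L ^\<^sub>m k) $$ (l, m) * lazy_step \<delta> n H f (Suc m))"
      using step by (intro sum.cong) auto
    also have "\<dots> = (lazy_step \<delta> n H ^^ Suc k) f (Suc l)"
      using Suc.IH[of "lazy_step \<delta> n H f"] by (simp add: funpow_swap1)
    finally show ?case .
  qed
  moreover have "i - 1 < n" "Suc (i - 1) = i" using assms by auto
  ultimately have "(\<Sum>j<n. (L ^\<^sub>m k) $$ (i - 1, j) * f (Suc j)) = (lazy_step \<delta> n H ^^ k) f i"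
    by metis
  with shift[of "\<lambda>j. (L ^\<^sub>m k) $$ (i - 1, j)" f] show ?thesis
    by (simp only: lazy_mat_def L_def)
qed

text \<open>
  Jensen's inequality for the square, with the part of the variance that is due to the choice
  between staying put (value \<open>a\<close>) and moving (value \<open>b j\<close>) kept on the right. This part is the gain from
  laziness; on a bipartite graph it is the only source of convergence.
\<close>

lemma jensen_square_lazy:
  fixes p b :: "'a \<Rightarrow> real"
  assumes "\<And>j. j \<in> A \<Longrightarrow> p j \<ge> 0" "sum p A = 1"
  shows "(\<delta> * a + (1 - \<delta>) * (\<Sum>j\<in>A. p j * b j))\<^sup>2
    \<le> \<delta> * a\<^sup>2 + (1 - \<delta>) * (\<Sum>j\<in>A. p j * (b j)\<^sup>2) - \<delta> * (1 - \<delta>) * (\<Sum>j\<in>A. p j * (a - b j)\<^sup>2)"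
proof -
  define m where "m = \<delta> * a + (1 - \<delta>) * (\<Sum>j\<in>A. p j * b j)"
  have mean: "(\<Sum>j\<in>A. p j * (\<delta> * a + (1 - \<delta>) * b j)) = m"
  proof -
    have "(\<Sum>j\<in>A. p j * (\<delta> * a + (1 - \<delta>) * b j)) = (\<Sum>j\<in>A. \<delta> * a * p j + (1 - \<delta>) * (p j * b j))"
      by (simp add: algebra_simps)
    also have "\<dots> = m" by (simp only: sum.distrib sum_distrib_left[symmetric] m_def assms(2) mult_1_right)
    finally show ?thesis .
  qed
  \<comment> \<open>The variance of \<open>\<delta> a + (1 - \<delta>) b j\<close> under \<open>p\<close> is non-negative; then
    \<open>(\<delta> a + (1 - \<delta>) b)\<^sup>2 = \<delta> a\<^sup>2 + (1 - \<delta>) b\<^sup>2 - \<delta> (1 - \<delta>) (a - b)\<^sup>2\<close>.\<close>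
  have "0 \<le> (\<Sum>j\<in>A. p j * (\<delta> * a + (1 - \<delta>) * b j - m)\<^sup>2)"
    using assms(1) by (intro sum_nonneg) auto
  also have "\<dots> = (\<Sum>j\<in>A. (\<delta> * a\<^sup>2 + m\<^sup>2) * p j + (1 - \<delta>) * (p j * (b j)\<^sup>2)
      - \<delta> * (1 - \<delta>) * (p j * (a - b j)\<^sup>2) - 2 * m * (p j * (\<delta> * a + (1 - \<delta>) * b j)))"
    by (intro sum.cong refl) (simp add: power2_eq_square algebra_simps)
  also have "\<dots> = (\<delta> * a\<^sup>2 + m\<^sup>2) * 1 + (1 - \<delta>) * (\<Sum>j\<in>A. p j * (b j)\<^sup>2)
      - \<delta> * (1 - \<delta>) * (\<Sum>j\<in>A. p j * (a - b j)\<^sup>2) - 2 * m * m"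
    by (simp only: sum.distrib sum_subtractf sum_distrib_left[symmetric] assms(2) mean)
  finally show ?thesis by (simp add: m_def[symmetric] power2_eq_square)
qed

context
  fixes n :: nat and H :: mgraph
  assumes H: "H \<in> graphs_on n"
begin

lemma deg_pos: "i \<in> {1..n} \<Longrightarrow> deg H i > 0"
  using H by (simp add: graphs_on_def)

lemma mult_commute: "mult H i j = mult H j i"
  using H unfolding graphs_on_def wf_mgraph_def by blast

text \<open>
  Detailed balance: the degrees are a reversible measure of the walk, as
  \<open>d\<^sub>i P(i, j) = A\<^sub>i\<^sub>j\<close> is symmetric.
\<close>

lemma sum_mult_eq_sum_deg:
  "(\<Sum>i\<in>{1..n}. \<Sum>j\<in>{1..n}. real (mult H i j) * f j) = (\<Sum>j\<in>{1..n}. real (deg H j) * f j)"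
proof -
  have "(\<Sum>i\<in>{1..n}. \<Sum>j\<in>{1..n}. real (mult H i j) * f j)
      = (\<Sum>j\<in>{1..n}. \<Sum>i\<in>{1..n}. real (mult H j i) * f j)"
    by (subst sum.swap) (simp add: mult_commute)
  then show ?thesis by (simp add: deg_eq_sum_mult[OF H] sum_distrib_right)
qed

lemma deg_lazy_step:
  fixes f :: "nat \<Rightarrow> real"
  assumes "i \<in> {1..n}"
  shows "deg H i * lazy_step \<delta> n H f i = \<delta> * (deg H i * f i) + (1 - \<delta>) * (\<Sum>j\<in>{1..n}. mult H i j * f j)"
proof -
  have "deg H i * (\<Sum>j\<in>{1..n}. mult H i j / deg H i * f j) = (\<Sum>j\<in>{1..n}. mult H i j * f j)"
    using deg_pos[OF assms] by (simp add: sum_distrib_left)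
  then show ?thesis
    by (simp only: lazy_step_def distrib_left mult.left_commute[of "real (deg H i)"])
qed

lemma lazy_step_mass:
  "(\<Sum>i\<in>{1..n}. deg H i * lazy_step \<delta> n H f i) = (\<Sum>i\<in>{1..n}. deg H i * f i)"
  for f :: "nat \<Rightarrow> real"
proof -
  have "(\<Sum>i\<in>{1..n}. deg H i * lazy_step \<delta> n H f i)
      = \<delta> * (\<Sum>i\<in>{1..n}. deg H i * f i) + (1 - \<delta>) * (\<Sum>i\<in>{1..n}. \<Sum>j\<in>{1..n}. mult H i j * f j)"
    by (simp add: deg_lazy_step sum.distrib sum_distrib_left)
  also have "\<dots> = (\<Sum>i\<in>{1..n}. deg H i * f i)"
    unfolding sum_mult_eq_sum_deg by (simp add: left_diff_distrib)
  finally show ?thesis .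
qed

lemma lazy_step_energy:
  "(\<Sum>i\<in>{1..n}. deg H i * (lazy_step \<delta> n H f i)\<^sup>2)
    \<le> (\<Sum>i\<in>{1..n}. deg H i * (f i)\<^sup>2)
      - \<delta> * (1 - \<delta>) * (\<Sum>i\<in>{1..n}. \<Sum>j\<in>{1..n}. mult H i j * (f i - f j)\<^sup>2)"
  for f :: "nat \<Rightarrow> real"
proof -
  have "deg H i * (lazy_step \<delta> n H f i)\<^sup>2
      \<le> \<delta> * (deg H i * (f i)\<^sup>2) + (1 - \<delta>) * (\<Sum>j\<in>{1..n}. mult H i j * (f j)\<^sup>2)
        - \<delta> * (1 - \<delta>) * (\<Sum>j\<in>{1..n}. mult H i j * (f i - f j)\<^sup>2)" if i: "i \<in> {1..n}" for i
  proof -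
    let ?p = "\<lambda>j. real (mult H i j) / deg H i"
    have "sum ?p {1..n} = real (deg H i) / deg H i"
      by (simp only: deg_eq_sum_mult[OF H] of_nat_sum sum_divide_distrib)
    then have "sum ?p {1..n} = 1" using deg_pos[OF i] by simp
    then have "(lazy_step \<delta> n H f i)\<^sup>2
      \<le> \<delta> * (f i)\<^sup>2 + (1 - \<delta>) * (\<Sum>j\<in>{1..n}. ?p j * (f j)\<^sup>2)
        - \<delta> * (1 - \<delta>) * (\<Sum>j\<in>{1..n}. ?p j * (f i - f j)\<^sup>2)"
      unfolding lazy_step_def by (intro jensen_square_lazy) auto
    then have "deg H i * (lazy_step \<delta> n H f i)\<^sup>2
      \<le> deg H i * (\<delta> * (f i)\<^sup>2 + (1 - \<delta>) * (\<Sum>j\<in>{1..n}. ?p j * (f j)\<^sup>2)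
        - \<delta> * (1 - \<delta>) * (\<Sum>j\<in>{1..n}. ?p j * (f i - f j)\<^sup>2))"
      by (intro mult_left_mono) auto
    moreover have "deg H i * (\<Sum>j\<in>{1..n}. ?p j * g j) = (\<Sum>j\<in>{1..n}. mult H i j * g j)" for g :: "nat \<Rightarrow> real"
      using deg_pos[OF i] by (simp add: sum_distrib_left)
    ultimately show ?thesis by (simp only: right_diff_distrib distrib_left mult.left_commute[of "real (deg H i)"])
  qed
  then have "(\<Sum>i\<in>{1..n}. deg H i * (lazy_step \<delta> n H f i)\<^sup>2)
      \<le> (\<Sum>i\<in>{1..n}. \<delta> * (deg H i * (f i)\<^sup>2) + (1 - \<delta>) * (\<Sum>j\<in>{1..n}. mult H i j * (f j)\<^sup>2)
        - \<delta> * (1 - \<delta>) * (\<Sum>j\<in>{1..n}. mult H i j * (f i - f j)\<^sup>2))"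
    by (rule sum_mono)
  also have "\<dots> = \<delta> * (\<Sum>i\<in>{1..n}. deg H i * (f i)\<^sup>2)
      + (1 - \<delta>) * (\<Sum>i\<in>{1..n}. \<Sum>j\<in>{1..n}. mult H i j * (f j)\<^sup>2)
      - \<delta> * (1 - \<delta>) * (\<Sum>i\<in>{1..n}. \<Sum>j\<in>{1..n}. mult H i j * (f i - f j)\<^sup>2)"
    by (simp only: sum.distrib sum_subtractf sum_distrib_left[symmetric])
  also have "\<dots> = (\<Sum>i\<in>{1..n}. deg H i * (f i)\<^sup>2)
      - \<delta> * (1 - \<delta>) * (\<Sum>i\<in>{1..n}. \<Sum>j\<in>{1..n}. mult H i j * (f i - f j)\<^sup>2)"
    unfolding sum_mult_eq_sum_deg by (simp add: left_diff_distrib)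
  finally show ?thesis .
qed

context
  fixes \<delta> :: real
  assumes \<delta>: "0 < \<delta>" "\<delta> < 1"
begin

text \<open>
  The squared difference along one edge is at most the Dirichlet sum, and this sum is
  controlled by the decrement of the energy, a convergent sequence.
\<close>

lemma lazy_walk_edge_difference:
  assumes "(i, j) \<in> adj H"
  shows "(\<lambda>k. (lazy_step \<delta> n H ^^ k) f i - (lazy_step \<delta> n H ^^ k) f j) \<longlonglongrightarrow> 0"
proof -
  define F where "F k = (lazy_step \<delta> n H ^^ k) f" for k
  define E where "E k = (\<Sum>i\<in>{1..n}. deg H i * (F k i)\<^sup>2)" for k
  define D where "D k = (\<Sum>i\<in>{1..n}. \<Sum>j\<in>{1..n}. mult H i j * (F k i - F k j)\<^sup>2)" for k
  have ij: "i \<in> {1..n}" "j \<in> {1..n}" "mult H i j \<ge> 1"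
    using assms adj_verts[of H i j] H by (auto simp: graphs_on_def adj_def)
  have E: "E (Suc k) \<le> E k - \<delta> * (1 - \<delta>) * D k" for k
    using lazy_step_energy[of \<delta> "F k"] by (simp add: E_def D_def F_def)
  have D: "(F k i - F k j)\<^sup>2 \<le> D k" for k
  proof -
    have "(F k i - F k j)\<^sup>2 \<le> mult H i j * (F k i - F k j)\<^sup>2"
      using mult_right_mono[of 1 "real (mult H i j)" "(F k i - F k j)\<^sup>2"] ij(3) by simp
    also have "\<dots> \<le> (\<Sum>j\<in>{1..n}. mult H i j * (F k i - F k j)\<^sup>2)"
      using ij(2) by (intro member_le_sum) auto
    also have "\<dots> \<le> D k"
      unfolding D_def
      using ij(1) by (intro member_le_sum[where f = "\<lambda>i. \<Sum>j\<in>{1..n}. mult H i j * (F k i - F k j)\<^sup>2"])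
        (auto intro: sum_nonneg)
    finally show ?thesis .
  qed
  have "D k \<ge> 0" for k using D[of k] by (meson order_trans zero_le_power2)
  then have "\<delta> * (1 - \<delta>) * D k \<ge> 0" for k using \<delta> by simp
  then have "decseq E" using E by (intro decseq_SucI) (smt (verit))
  moreover have "E k \<ge> 0" for k by (auto simp: E_def intro: sum_nonneg)
  ultimately obtain l where l: "E \<longlonglongrightarrow> l" using decseq_convergent[of E 0] by blast
  have "(\<lambda>k. (E k - E (Suc k)) / (\<delta> * (1 - \<delta>))) \<longlonglongrightarrow> (l - l) / (\<delta> * (1 - \<delta>))"
    using \<delta> by (intro tendsto_intros l LIMSEQ_Suc) auto
  moreover have "(F k i - F k j)\<^sup>2 \<le> (E k - E (Suc k)) / (\<delta> * (1 - \<delta>))" for k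
  proof -
    have "D k \<le> (E k - E (Suc k)) / (\<delta> * (1 - \<delta>))"
      using E[of k] \<delta> by (simp add: pos_le_divide_eq mult.commute[of "D k"])
    with D[of k] show ?thesis by linarith
  qed
  ultimately have "(\<lambda>k. (F k i - F k j)\<^sup>2) \<longlonglongrightarrow> 0"
    by (intro tendsto_sandwich[of "\<lambda>_. 0" "\<lambda>k. (F k i - F k j)\<^sup>2"]) (auto intro: always_eventually)
  then show ?thesis by (simp add: F_def)
qed

text \<open>
  Chaining edges of a path shows that the iterates become constant; the conserved weighted mean
  identifies the constant.
\<close>

lemma lazy_walk_converges:
  assumes conn: "mg_connected H" and i: "i \<in> {1..n}"
  shows "(\<lambda>k. (lazy_step \<delta> n H ^^ k) f i) \<longlonglongrightarrow> (\<Sum>j\<in>{1..n}. stat_dist n H j * f j)"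
proof -
  define F where "F k = (lazy_step \<delta> n H ^^ k) f" for k
  define S where "S = (\<Sum>l\<in>{1..n}. real (deg H l))"
  have st: "stat_dist n H j = deg H j / S" for j by (simp add: stat_dist_def S_def)
  have S: "S > 0" unfolding S_def using i deg_pos by (intro sum_pos) auto
  have diff: "(\<lambda>k. F k i - F k j) \<longlonglongrightarrow> 0" if "j \<in> {1..n}" for j
  proof -
    have "(i, j) \<in> (adj H)\<^sup>*" using conn i that H by (auto simp: mg_connected_def graphs_on_def)
    then show ?thesis
    proof induction
      case (step y z)
      from tendsto_add[OF step.IH lazy_walk_edge_difference[OF step.hyps(2), of f]]
      show ?case by (simp add: F_def)
    qed simp
  qed
  have mass: "(\<Sum>j\<in>{1..n}. deg H j * F k j) = (\<Sum>j\<in>{1..n}. deg H j * f j)" for k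
    by (induction k) (simp_all only: F_def funpow.simps o_def id_apply lazy_step_mass)
  have "F k i = (\<Sum>j\<in>{1..n}. stat_dist n H j * (F k i - F k j)) + (\<Sum>j\<in>{1..n}. stat_dist n H j * f j)" for k
  proof -
    have "(\<Sum>j\<in>{1..n}. stat_dist n H j * (F k i - F k j))
        = (\<Sum>j\<in>{1..n}. deg H j * F k i) / S - (\<Sum>j\<in>{1..n}. deg H j * F k j) / S"
      by (simp add: st right_diff_distrib sum_subtractf sum_divide_distrib diff_divide_distrib)
    also have "\<dots> = F k i - (\<Sum>j\<in>{1..n}. deg H j * f j) / S"
      using S mass[of k] by (simp add: sum_distrib_right[symmetric] S_def)
    finally show ?thesis by (simp add: st sum_divide_distrib)
  qed
  moreover have "(\<lambda>k. (\<Sum>j\<in>{1..n}. stat_dist n H j * (F k i - F k j)) + (\<Sum>j\<in>{1..n}. stat_dist n H j * f j))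
      \<longlonglongrightarrow> (\<Sum>j\<in>{1..n}. stat_dist n H j * 0) + (\<Sum>j\<in>{1..n}. stat_dist n H j * f j)"
    by (intro tendsto_intros diff)
  ultimately show ?thesis by (simp add: F_def[symmetric])
qed

lemma mu_lazy_weak_conv:
  assumes "n \<ge> 1" "mg_connected H"
  shows "weak_conv_m (\<lambda>k. mu_lazy \<delta> k n H) (mu_st n H)"
  unfolding mu_lazy_def mu_st_def
proof (rule weak_conv_m_empirical[OF assms(1)])
  fix i assume i: "i \<in> {1..n}"
  show "(\<lambda>k. bias_lazy \<delta> k n H i) \<longlonglongrightarrow> bias_st n H i"
    unfolding bias_lazy_def bias_st_def lazy_mat_eq_lazy_step[OF i]
    by (intro tendsto_intros lazy_walk_converges[OF assms(2) i])
qed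

end

end

section \<open>The degree of the root\<close>

lemma deg_root_ball:
  assumes "conn_lf_rooted X"
  shows "deg (fst (root_ball 1 X)) (snd (root_ball 1 X)) = deg (fst X) (snd X)"
proof -
  obtain H z where X: "X = (H, z)" by (cases X)
  have "gdist H z u \<le> enat 1" if "mult H z u > 0 \<or> u = z" for u
    unfolding gdist_le_iff
  proof (cases "u = z")
    case False
    then have "(z, u) \<in> adj H ^^ 1" using that by (auto simp: adj_def)
    then show "\<exists>k\<le>1. (z, u) \<in> adj H ^^ k" by blast
  qed (auto intro!: exI[of _ 0])
  then have "mult (fst (root_ball 1 X)) z u = mult H z u" for u
    by (cases "mult H z u > 0") (auto simp: X root_ball_def induced_def)
  then show ?thesis by (simp add: X deg_def root_ball_def)
qed

text \<open>
  A distance below \<open>1 / 2\<close> means that the supremum of the radii with isomorphic balls exceeds 1,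
  so that the balls of radius 1 are isomorphic.
\<close>

lemma dist_less_half_imp_root_deg_eq: "dist x y < 1 / 2 \<Longrightarrow> root_deg x = root_deg y"
proof transfer
  fix X Y assume "rgraph_rel X X" "rgraph_rel Y Y" and d: "local_dist X Y < 1 / 2"
  then have X: "conn_lf_rooted X" and Y: "conn_lf_rooted Y" by (auto simp: rgraph_rel_def)
  let ?D = "{r. rooted_iso (root_ball r X) (root_ball r Y)}"
  have "\<exists>r\<in>?D. r \<ge> 1"
  proof (rule ccontr)
    assume "\<not> ?thesis"
    then have "(SUP r\<in>?D. of_nat r :: ennreal) \<le> 1" by (intro SUP_least) auto
    then have "1 + (SUP r\<in>?D. of_nat r :: ennreal) \<le> 2"
      using add_left_mono[of _ 1 "1 :: ennreal"] by fastforce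
    then have "inverse 2 \<le> inverse (1 + (SUP r\<in>?D. of_nat r :: ennreal))"
      by (rule ennreal_inverse_antimono)
    then have "enn2real (inverse 2) \<le> local_dist X Y" unfolding local_dist_def
      by (intro enn2real_mono) (auto simp: less_top[symmetric])
    moreover have "inverse 2 = ennreal (1 / 2)"
      by (metis ennreal_numeral inverse_ennreal zero_less_numeral inverse_eq_divide)
    then have "enn2real (inverse 2) = 1 / 2" by (simp only: enn2real_ennreal)
    ultimately show False using d by simp
  qed
  then obtain f where f: "rooted_iso_by f (root_ball 1 X) (root_ball 1 Y)"
    using rooted_iso_ball_mono[of X Y _ 1] X Y by (auto simp: conn_lf_rooted_def rooted_iso_def)
  have "deg (fst (root_ball 1 Y)) (f (snd (root_ball 1 X))) = deg (fst (root_ball 1 X)) (snd (root_ball 1 X))"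
    using X Y by (intro rooted_iso_by_deg[OF f] wf_root_ball root_in_ball) (auto simp: conn_lf_rooted_def)
  moreover have "f (snd (root_ball 1 X)) = snd (root_ball 1 Y)" using f by (simp add: rooted_iso_by_def)
  ultimately show "(case X of (H, z) \<Rightarrow> deg H z) = (case Y of (H, z) \<Rightarrow> deg H z)"
    using deg_root_ball[OF X] deg_root_ball[OF Y] by (simp add: split_beta)
qed

lemma continuous_on_root_deg:
  fixes g :: "nat \<Rightarrow> real"
  shows "continuous_on UNIV (\<lambda>x. g (root_deg x))"
  unfolding continuous_on_iff
proof safe
  fix x :: rgraph and e :: real assume "e > 0"
  show "\<exists>d>0. \<forall>x'\<in>UNIV. dist x' x < d \<longrightarrow> dist (g (root_deg x')) (g (root_deg x)) < e"
  proof (intro exI[of _ "1 / 2"] conjI ballI impI)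
    fix x' assume "dist x' x < 1 / 2"
    then have "root_deg x' = root_deg x" by (rule dist_less_half_imp_root_deg_eq)
    then show "dist (g (root_deg x')) (g (root_deg x)) < e" using \<open>e > 0\<close> by simp
  qed simp
qed

lemma nontrivial_imp_root_deg_pos: "nontrivial x \<Longrightarrow> root_deg x > 0"
proof transfer
  fix X assume "rgraph_rel X X" and nt: "case X of (H, z) \<Rightarrow> \<exists>u\<in>verts H. \<exists>v\<in>verts H. u \<noteq> v"
  obtain H z where X: "X = (H, z)" by (cases X)
  have c: "conn_lf_rooted (H, z)" using \<open>rgraph_rel X X\<close> by (simp add: rgraph_rel_def X)
  obtain w where w: "w \<in> verts H" "w \<noteq> z" using nt by (auto simp: X)
  have "(z, w) \<in> (adj H)\<^sup>*" using c w by (simp add: conn_lf_rooted_def mg_connected_def)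
  then obtain y where y: "mult H z y > 0"
    using w(2) by (auto elim: converse_rtranclE simp: adj_def)
  have "finite {u. mult H z u > 0}" using c by (simp add: conn_lf_rooted_def locally_finite_def)
  then have "mult H z y \<le> (\<Sum>u | mult H z u > 0. mult H z u)" using y by (intro member_le_sum) auto
  then show "(case X of (H, z) \<Rightarrow> deg H z) > 0" using y by (simp add: X deg_def)
qed

lemma root_deg_component:
  assumes "H \<in> graphs_on n" "i \<in> {1..n}"
  shows "root_deg (component H i) = deg H i"
proof -
  let ?S = "{v. (i, v) \<in> (adj H)\<^sup>*}"
  have "mult (induced H ?S) i u = mult H i u" for u
    by (cases "mult H i u > 0") (auto simp: induced_def adj_def)
  moreover have "rgraph_rel (induced H ?S, i) (induced H ?S, i)"
    using component_conn_lf_rooted[OF assms] by (simp add: rgraph_rel_def rooted_iso_refl)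
  ultimately show ?thesis by (simp add: component_def root_deg.abs_eq deg_def)
qed


section \<open>Convergence in probability along random graphs\<close>

definition deg_mean :: "nat \<Rightarrow> (nat \<Rightarrow> real) \<Rightarrow> mgraph \<Rightarrow> real" where
  "deg_mean n \<phi> H = (\<Sum>i\<in>{1..n}. \<phi> (deg H i)) / n"

lemma deg_mean_mono: "(\<And>d. \<phi> d \<le> \<psi> d) \<Longrightarrow> deg_mean n \<phi> H \<le> deg_mean n \<psi> H"
  unfolding deg_mean_def by (intro divide_right_mono sum_mono) auto

lemma deg_mean_add: "deg_mean n (\<lambda>d. \<phi> d + \<psi> d) H = deg_mean n \<phi> H + deg_mean n \<psi> H"
  by (simp add: deg_mean_def sum.distrib add_divide_distrib)

lemma deg_mean_diff: "deg_mean n (\<lambda>d. \<phi> d - \<psi> d) H = deg_mean n \<phi> H - deg_mean n \<psi> H"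
  by (simp add: deg_mean_def sum_subtractf diff_divide_distrib)

lemma deg_mean_cmult: "deg_mean n (\<lambda>d. c * \<phi> d) H = c * deg_mean n \<phi> H"
  by (simp add: deg_mean_def sum_distrib_left)

lemma deg_mean_abs: "\<bar>deg_mean n \<phi> H\<bar> \<le> deg_mean n (\<lambda>d. \<bar>\<phi> d\<bar>) H"
  by (simp add: deg_mean_def divide_right_mono)

lemma deg_mean_const: "n > 0 \<Longrightarrow> deg_mean n (\<lambda>_. c) H = c"
  by (simp add: deg_mean_def)

lemma measurable_root_deg:
  fixes g :: "nat \<Rightarrow> real"
  assumes "sets \<Lambda> = sets borel"
  shows "(\<lambda>x. g (root_deg x)) \<in> borel_measurable \<Lambda>"
  using borel_measurable_continuous_onI[OF continuous_on_root_deg[of g]]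
  by (simp add: measurable_cong_sets[OF assms refl])

lemma integrable_bounded_root_deg:
  fixes g :: "nat \<Rightarrow> real"
  assumes "prob_space \<Lambda>" "sets \<Lambda> = sets borel" "bounded (range g)"
  shows "integrable \<Lambda> (\<lambda>x. g (root_deg x))"
proof -
  interpret prob_space \<Lambda> by fact
  obtain B where "\<And>d. norm (g d) \<le> B" using assms(3) by (auto simp: bounded_iff)
  then show ?thesis by (intro integrable_const_bound[of _ B] measurable_root_deg assms(2)) auto
qed

locale random_graph_sequence =
  fixes M :: "nat \<Rightarrow> 'w measure" and G :: "nat \<Rightarrow> 'w \<Rightarrow> mgraph"
  assumes random_graph: "n \<ge> 2 \<Longrightarrow> random_graph n (M n) (G n)"
begin

lemma prob_space_M: "n \<ge> 2 \<Longrightarrow> prob_space (M n)"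
  using random_graph by (simp add: random_graph_def)

lemma G_in_graphs_on: "n \<ge> 2 \<Longrightarrow> \<omega> \<in> space (M n) \<Longrightarrow> G n \<omega> \<in> graphs_on n"
  using random_graph[of n] by (auto simp: random_graph_def dest: measurable_space)

lemma measurable_G: "n \<ge> 2 \<Longrightarrow> (\<lambda>\<omega>. f (G n \<omega>)) \<in> borel_measurable (M n)"
  using random_graph[of n] by (auto simp: random_graph_def intro: measurable_compose)

lemma event_G: "n \<ge> 2 \<Longrightarrow> {\<omega> \<in> space (M n). P (G n \<omega>)} \<in> sets (M n)"
proof -
  let ?f = "\<lambda>\<omega>. if P (G n \<omega>) then 1 else 0 :: real"
  assume "n \<ge> 2"
  then have "?f -` {1} \<inter> space (M n) \<in> sets (M n)"
    by (intro measurable_sets[OF measurable_G[of n "\<lambda>H. if P H then 1 else 0"]]) auto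
  moreover have "?f -` {1} \<inter> space (M n) = {\<omega> \<in> space (M n). P (G n \<omega>)}"
    by (auto split: if_splits)
  ultimately show ?thesis by simp
qed

text \<open>
  ``With high probability'', for events that depend only on the graph. Such events are
  measurable for \<open>n \<ge> 2\<close>, which makes the notion closed under consequences and conjunctions, so
  that the limit arguments below become deterministic statements about a single graph.
\<close>

definition whp :: "(nat \<Rightarrow> mgraph \<Rightarrow> bool) \<Rightarrow> bool" where
  "whp E \<longleftrightarrow> (\<lambda>n. measure (M n) {\<omega> \<in> space (M n). \<not> E n (G n \<omega>)}) \<longlonglongrightarrow> 0"

lemma tendsto_in_prob_iff_whp:
  "tendsto_in_prob M (\<lambda>n \<omega>. X n (G n \<omega>)) c \<longleftrightarrow> (\<forall>\<epsilon>>0. whp (\<lambda>n H. \<bar>X n H - c\<bar> \<le> \<epsilon>))"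
  by (simp add: tendsto_in_prob_def whp_def not_le)

lemma tendsto_in_prob_imp_whp:
  "tendsto_in_prob M (\<lambda>n \<omega>. X n (G n \<omega>)) c \<Longrightarrow> \<epsilon> > 0 \<Longrightarrow> whp (\<lambda>n H. \<bar>X n H - c\<bar> \<le> \<epsilon>)"
  by (simp add: tendsto_in_prob_iff_whp)

lemma measure_G_mono:
  assumes "n \<ge> 2" "\<And>H. H \<in> graphs_on n \<Longrightarrow> P H \<Longrightarrow> Q H"
  shows "measure (M n) {\<omega> \<in> space (M n). P (G n \<omega>)} \<le> measure (M n) {\<omega> \<in> space (M n). Q (G n \<omega>)}"
proof -
  interpret prob_space "M n" using prob_space_M[OF assms(1)] .
  show ?thesis using assms G_in_graphs_on[OF assms(1)] event_G[OF assms(1), of Q]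
    by (intro finite_measure_mono) auto
qed

lemma measure_G_union:
  assumes "n \<ge> 2" "\<And>H. H \<in> graphs_on n \<Longrightarrow> P H \<Longrightarrow> Q H \<or> R H"
  shows "measure (M n) {\<omega> \<in> space (M n). P (G n \<omega>)}
    \<le> measure (M n) {\<omega> \<in> space (M n). Q (G n \<omega>)} + measure (M n) {\<omega> \<in> space (M n). R (G n \<omega>)}"
proof -
  interpret prob_space "M n" using prob_space_M[OF assms(1)] .
  have "measure (M n) {\<omega> \<in> space (M n). P (G n \<omega>)}
      \<le> measure (M n) ({\<omega> \<in> space (M n). Q (G n \<omega>)} \<union> {\<omega> \<in> space (M n). R (G n \<omega>)})"
    using assms G_in_graphs_on[OF assms(1)] event_G[OF assms(1), of Q] event_G[OF assms(1), of R]
    by (intro finite_measure_mono) auto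
  also have "\<dots> \<le> measure (M n) {\<omega> \<in> space (M n). Q (G n \<omega>)} + measure (M n) {\<omega> \<in> space (M n). R (G n \<omega>)}"
    using event_G[OF assms(1)] by (intro measure_subadditive) auto
  finally show ?thesis .
qed

lemma whp_mono:
  assumes "whp E" "\<And>n H. n \<ge> 2 \<Longrightarrow> H \<in> graphs_on n \<Longrightarrow> E n H \<Longrightarrow> F n H"
  shows "whp F"
  unfolding whp_def
proof (rule tendsto_sandwich[OF _ _ tendsto_const assms(1)[unfolded whp_def]])
  show "eventually (\<lambda>n. measure (M n) {\<omega> \<in> space (M n). \<not> F n (G n \<omega>)}
      \<le> measure (M n) {\<omega> \<in> space (M n). \<not> E n (G n \<omega>)}) sequentially"
    using eventually_ge_at_top[of 2]
  proof eventually_elim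
    case (elim n)
    show ?case
      using assms(2)[OF elim]
      by (intro measure_G_mono[OF elim, where P = "\<lambda>H. \<not> F n H" and Q = "\<lambda>H. \<not> E n H"]) blast
  qed
qed simp

lemma whp_conj:
  assumes "whp E" "whp F"
  shows "whp (\<lambda>n H. E n H \<and> F n H)"
  unfolding whp_def
proof (rule tendsto_sandwich[OF _ _ tendsto_const])
  show "(\<lambda>n. measure (M n) {\<omega> \<in> space (M n). \<not> E n (G n \<omega>)}
      + measure (M n) {\<omega> \<in> space (M n). \<not> F n (G n \<omega>)}) \<longlonglongrightarrow> 0"
    using tendsto_add[OF assms[unfolded whp_def]] by simp
  show "eventually (\<lambda>n. measure (M n) {\<omega> \<in> space (M n). \<not> (E n (G n \<omega>) \<and> F n (G n \<omega>))}
      \<le> measure (M n) {\<omega> \<in> space (M n). \<not> E n (G n \<omega>)}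
        + measure (M n) {\<omega> \<in> space (M n). \<not> F n (G n \<omega>)}) sequentially"
    using eventually_ge_at_top[of 2]
  proof eventually_elim
    case (elim n)
    show ?case
      by (rule measure_G_union[OF elim, where P = "\<lambda>H. \<not> (E n H \<and> F n H)"
            and Q = "\<lambda>H. \<not> E n H" and R = "\<lambda>H. \<not> F n H"]) blast
  qed
qed simp

lemma deg_mean_bounded_tendsto:
  assumes "local_conv_in_prob M G \<Lambda>" "bounded (range \<phi>)"
  shows "tendsto_in_prob M (\<lambda>n \<omega>. deg_mean n \<phi> (G n \<omega>)) (\<integral>x. \<phi> (root_deg x) \<partial>\<Lambda>)"
proof -
  define Y where "Y n H = (\<Sum>i\<in>{1..n}. \<phi> (root_deg (component H i))) / real n" for n H
  have "bounded (range (\<lambda>x. \<phi> (root_deg x)))" by (rule bounded_subset[OF assms(2)]) auto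
  then have "tendsto_in_prob M (\<lambda>n \<omega>. Y n (G n \<omega>)) (\<integral>x. \<phi> (root_deg x) \<partial>\<Lambda>)"
    using assms(1) continuous_on_root_deg[of \<phi>] unfolding local_conv_in_prob_def Y_def by blast
  moreover have "Y n H = deg_mean n \<phi> H" if "H \<in> graphs_on n" for n H
    using root_deg_component[OF that] by (simp add: Y_def deg_mean_def)
  ultimately show ?thesis
    unfolding tendsto_in_prob_iff_whp[of Y] tendsto_in_prob_iff_whp[of "\<lambda>n. deg_mean n \<phi>"]
    by (auto elim!: whp_mono)
qed

subsection \<open>Uniformly integrable squared degrees\<close>

definition tail_square :: "real \<Rightarrow> nat \<Rightarrow> real" where
  "tail_square K d = (if (real d)\<^sup>2 > K then (real d)\<^sup>2 else 0)"

context
  assumes UI: "unif_integrable {(n, i). n \<ge> 2 \<and> i \<in> {1..n}} (\<lambda>(n, i). M n)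
    (\<lambda>(n, i) \<omega>. (real (deg (G n \<omega>) i))\<^sup>2)"
begin

text \<open>
  The expectation of the averaged tail is at most the supremum of the tail expectations, so
  Markov's inequality gives a bound that is uniform in \<open>n\<close>.
\<close>

lemma deg_mean_tail_square_small:
  fixes t \<eta> :: real
  assumes "t > 0" "\<eta> > 0"
  shows "eventually (\<lambda>K. \<forall>n\<ge>2. measure (M n) {\<omega> \<in> space (M n). deg_mean n (tail_square K) (G n \<omega>) > t} \<le> \<eta>) at_top"
proof -
  let ?X = "\<lambda>(n, i) \<omega>. (real (deg (G n \<omega>) i))\<^sup>2"
  let ?I = "{(n, i). n \<ge> 2 \<and> i \<in> {1..n}} :: (nat \<times> nat) set"
  have "eventually (\<lambda>K. (SUP p\<in>?I. \<integral>\<^sup>+\<omega>. ennreal (?X p \<omega> * indicator {\<omega>. ?X p \<omega> > K} \<omega>) \<partial>(case p of (n, i) \<Rightarrow> M n))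
      < ennreal (t * \<eta>)) at_top"
    by (rule order_tendstoD(2)[OF UI[unfolded unif_integrable_def]]) (use assms in simp)
  then show ?thesis
  proof eventually_elim
    case (elim K)
    have tail: "(\<integral>\<^sup>+\<omega>. ennreal (tail_square K (deg (G n \<omega>) i)) \<partial>M n) \<le> ennreal (t * \<eta>)"
      if "n \<ge> 2" "i \<in> {1..n}" for n i
    proof -
      have "(\<integral>\<^sup>+\<omega>. ennreal (tail_square K (deg (G n \<omega>) i)) \<partial>M n)
          = (\<integral>\<^sup>+\<omega>. ennreal (?X (n, i) \<omega> * indicator {\<omega>. ?X (n, i) \<omega> > K} \<omega>) \<partial>(case (n, i) of (n, i) \<Rightarrow> M n))"
        by (auto simp: tail_square_def intro!: nn_integral_cong)
      also have "\<dots> \<le> (SUP p\<in>?I. \<integral>\<^sup>+\<omega>. ennreal (?X p \<omega> * indicator {\<omega>. ?X p \<omega> > K} \<omega>) \<partial>(case p of (n, i) \<Rightarrow> M n))"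
        using that by (intro SUP_upper) simp
      finally show ?thesis using elim by simp
    qed
    show ?case
    proof (intro allI impI)
      fix n :: nat assume n: "n \<ge> 2"
      interpret prob_space "M n" using prob_space_M[OF n] .
      have [measurable]: "(\<lambda>\<omega>. deg_mean n (tail_square K) (G n \<omega>)) \<in> borel_measurable (M n)"
        by (rule measurable_G[OF n])
      have [measurable]: "(\<lambda>\<omega>. tail_square K (deg (G n \<omega>) i)) \<in> borel_measurable (M n)" for i
        by (rule measurable_G[OF n, of "\<lambda>H. tail_square K (deg H i)"])
      have nonneg: "tail_square K d \<ge> 0" for d by (simp add: tail_square_def)
      have "(\<integral>\<^sup>+\<omega>. ennreal (deg_mean n (tail_square K) (G n \<omega>)) \<partial>M n)
          = (\<integral>\<^sup>+\<omega>. ennreal (1 / n) * (\<Sum>i\<in>{1..n}. ennreal (tail_square K (deg (G n \<omega>) i))) \<partial>M n)"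
        by (intro nn_integral_cong)
          (simp add: deg_mean_def nonneg ennreal_mult[symmetric] sum_nonneg)
      also have "\<dots> = ennreal (1 / n) * (\<Sum>i\<in>{1..n}. \<integral>\<^sup>+\<omega>. ennreal (tail_square K (deg (G n \<omega>) i)) \<partial>M n)"
        by (subst nn_integral_cmult) (auto simp: nn_integral_sum)
      also have "\<dots> \<le> ennreal (1 / n) * (\<Sum>i\<in>{1..n}. ennreal (t * \<eta>))"
        using tail[OF n] by (intro mult_left_mono sum_mono) auto
      also have "\<dots> = ennreal (t * \<eta>)"
        using n assms by (simp add: ennreal_mult[symmetric] ennreal_of_nat_eq_real_of_nat)
      finally have int: "(\<integral>\<^sup>+\<omega>. ennreal (deg_mean n (tail_square K) (G n \<omega>)) \<partial>M n) \<le> ennreal (t * \<eta>)" .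
      let ?u = "\<lambda>\<omega>. ennreal (deg_mean n (tail_square K) (G n \<omega>))"
      have "emeasure (M n) {\<omega> \<in> space (M n). 1 \<le> ennreal (1 / t) * ?u \<omega>}
          \<le> ennreal (1 / t) * (\<integral>\<^sup>+\<omega>. ?u \<omega> * indicator (space (M n)) \<omega> \<partial>M n)"
        by (rule nn_integral_Markov_inequality) auto
      also have "(\<integral>\<^sup>+\<omega>. ?u \<omega> * indicator (space (M n)) \<omega> \<partial>M n) = (\<integral>\<^sup>+\<omega>. ?u \<omega> \<partial>M n)"
        by (intro nn_integral_cong) simp
      also have "ennreal (1 / t) * (\<integral>\<^sup>+\<omega>. ?u \<omega> \<partial>M n) \<le> ennreal (1 / t) * ennreal (t * \<eta>)"
        using int by (rule mult_left_mono) simp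
      also have "\<dots> = ennreal \<eta>" using assms by (simp add: ennreal_mult[symmetric])
      finally have "emeasure (M n) {\<omega> \<in> space (M n). 1 \<le> ennreal (1 / t) * ennreal (deg_mean n (tail_square K) (G n \<omega>))} \<le> ennreal \<eta>" .
      moreover have "emeasure (M n) {\<omega> \<in> space (M n). deg_mean n (tail_square K) (G n \<omega>) > t}
         \<le> emeasure (M n) {\<omega> \<in> space (M n). 1 \<le> ennreal (1 / t) * ennreal (deg_mean n (tail_square K) (G n \<omega>))}"
      proof (intro emeasure_mono subsetI CollectI; (elim CollectE conjE)?)
        fix \<omega> assume "\<omega> \<in> space (M n)" "deg_mean n (tail_square K) (G n \<omega>) > t"
        then show "\<omega> \<in> space (M n) \<and> 1 \<le> ennreal (1 / t) * ennreal (deg_mean n (tail_square K) (G n \<omega>))"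
          using assms by (simp add: ennreal_mult[symmetric] ennreal_1[symmetric] del: ennreal_1)
      qed measurable
      ultimately have "emeasure (M n) {\<omega> \<in> space (M n). deg_mean n (tail_square K) (G n \<omega>) > t} \<le> ennreal \<eta>"
        by (rule order_trans[rotated])
      then show "measure (M n) {\<omega> \<in> space (M n). deg_mean n (tail_square K) (G n \<omega>) > t} \<le> \<eta>"
        using assms by (simp add: emeasure_eq_measure)
    qed
  qed
qed

context
  fixes \<Lambda> :: "rgraph measure"
  assumes prob: "prob_space \<Lambda>" and sets_eq: "sets \<Lambda> = sets borel"
    and conv: "local_conv_in_prob M G \<Lambda>"
begin

text \<open>
  The truncated second moments of the limit are limits in probability of truncated empirical second
  moments. By uniform integrability the latter exceed \<open>K + 1\<close> with probability at most \<open>1 / 3\<close> for some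
  fixed \<open>K\<close>, uniformly in the truncation; so the former are bounded, and monotone convergence applies.
\<close>

lemma integrable_root_deg_square: "integrable \<Lambda> (\<lambda>x. (real (root_deg x))\<^sup>2)"
proof -
  interpret prob_space \<Lambda> by (rule prob)
  have "eventually (\<lambda>K. (\<forall>n\<ge>2. measure (M n) {\<omega> \<in> space (M n). deg_mean n (tail_square K) (G n \<omega>) > 1} \<le> 1 / 3) \<and> K \<ge> 0) at_top"
    by (intro eventually_conj eventually_ge_at_top deg_mean_tail_square_small) auto
  from eventually_happens[OF this] obtain K where K: "K \<ge> 0"
    "\<And>n. n \<ge> 2 \<Longrightarrow> measure (M n) {\<omega> \<in> space (M n). deg_mean n (tail_square K) (G n \<omega>) > 1} \<le> 1 / 3"
    by auto
  define q where "q N d = min ((real d)\<^sup>2) (real N)" for N d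
  have bq: "bounded (range (q N))" for N
    by (rule boundedI[of _ "real N"]) (auto simp: q_def min_def)
  have bound: "(\<integral>x. q N (root_deg x) \<partial>\<Lambda>) \<le> K + 2" for N
  proof (rule ccontr)
    assume *: "\<not> ?thesis"
    have "whp (\<lambda>n H. \<bar>deg_mean n (q N) H - (\<integral>x. q N (root_deg x) \<partial>\<Lambda>)\<bar> \<le> 1)"
      by (intro tendsto_in_prob_imp_whp[of "\<lambda>n. deg_mean n (q N)"] deg_mean_bounded_tendsto[OF conv bq]) simp
    then have "eventually (\<lambda>n. measure (M n) {\<omega> \<in> space (M n).
        \<not> \<bar>deg_mean n (q N) (G n \<omega>) - (\<integral>x. q N (root_deg x) \<partial>\<Lambda>)\<bar> \<le> 1} < 1 / 3) sequentially"
      unfolding whp_def by (rule order_tendstoD) simp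
    then have "eventually (\<lambda>n. measure (M n) {\<omega> \<in> space (M n).
        \<not> \<bar>deg_mean n (q N) (G n \<omega>) - (\<integral>x. q N (root_deg x) \<partial>\<Lambda>)\<bar> \<le> 1} < 1 / 3 \<and> n \<ge> 2) sequentially"
      by (intro eventually_conj eventually_ge_at_top)
    then obtain n where n: "n \<ge> 2" and small: "measure (M n) {\<omega> \<in> space (M n).
        \<not> \<bar>deg_mean n (q N) (G n \<omega>) - (\<integral>x. q N (root_deg x) \<partial>\<Lambda>)\<bar> \<le> 1} < 1 / 3"
      using eventually_happens[of _ sequentially] by auto
    have "deg_mean n (q N) H \<le> K + deg_mean n (tail_square K) H" for H
    proof -
      have "deg_mean n (q N) H \<le> deg_mean n (\<lambda>d. K + tail_square K d) H"
        using K(1) by (intro deg_mean_mono) (auto simp: q_def tail_square_def)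
      then show ?thesis using n by (simp add: deg_mean_add deg_mean_const)
    qed
    \<comment> \<open>If the integral exceeded \<open>K + 2\<close>, two events of probability at most \<open>1 / 3\<close> would cover the space.\<close>
    then have "measure (M n) {\<omega> \<in> space (M n). True}
      \<le> measure (M n) {\<omega> \<in> space (M n). deg_mean n (tail_square K) (G n \<omega>) > 1}
        + measure (M n) {\<omega> \<in> space (M n). \<not> \<bar>deg_mean n (q N) (G n \<omega>) - (\<integral>x. q N (root_deg x) \<partial>\<Lambda>)\<bar> \<le> 1}"
      using * by (intro measure_G_union[OF n, where P = "\<lambda>_. True"
            and Q = "\<lambda>H. deg_mean n (tail_square K) H > 1"
            and R = "\<lambda>H. \<not> \<bar>deg_mean n (q N) H - (\<integral>x. q N (root_deg x) \<partial>\<Lambda>)\<bar> \<le> 1"]) (smt (verit))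
    moreover have "measure (M n) {\<omega> \<in> space (M n). True} = 1"
      using prob_space.prob_space[OF prob_space_M[OF n]] by simp
    ultimately show False using small K(2)[OF n] by linarith
  qed
  have mono: "mono (\<lambda>N. q N d)" for d by (auto simp: mono_def q_def)
  have "incseq (\<lambda>N. \<integral>x. q N (root_deg x) \<partial>\<Lambda>)"
    using mono by (intro incseq_SucI integral_mono integrable_bounded_root_deg prob sets_eq bq) (auto simp: mono_def)
  then obtain l where l: "(\<lambda>N. \<integral>x. q N (root_deg x) \<partial>\<Lambda>) \<longlonglongrightarrow> l"
    using incseq_convergent bound by blast
  have "(\<lambda>N. q N d) \<longlonglongrightarrow> (real d)\<^sup>2" for d
  proof (rule tendsto_eventually)
    show "eventually (\<lambda>N. q N d = (real d)\<^sup>2) sequentially"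
      using eventually_ge_at_top[of "d\<^sup>2"]
    proof eventually_elim
      case (elim N)
      then have "(real d)\<^sup>2 \<le> real N" by (metis of_nat_le_iff of_nat_power)
      then show ?case by (simp add: q_def)
    qed
  qed
  note lim = this
  show ?thesis
  proof (rule integrable_monotone_convergence[OF _ _ _ l])
    show "integrable \<Lambda> (\<lambda>x. q N (root_deg x))" for N
      by (rule integrable_bounded_root_deg[OF prob sets_eq bq])
    show "AE x in \<Lambda>. mono (\<lambda>N. q N (root_deg x))" by (rule AE_I2) (rule mono)
    show "AE x in \<Lambda>. (\<lambda>N. q N (root_deg x)) \<longlonglongrightarrow> (real (root_deg x))\<^sup>2" by (rule AE_I2) (rule lim)
    show "(\<lambda>x. (real (root_deg x))\<^sup>2) \<in> borel_measurable \<Lambda>" by (rule measurable_root_deg[OF sets_eq])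
  qed
qed

text \<open>
  Setting \<open>\<phi>\<close> to 0 on the degrees with square above \<open>K\<close> gives a bounded function, for which local convergence
  suffices. The error is at most the averaged tail on the side of the graphs, and it vanishes by
  dominated convergence on the side of the limit, both as \<open>K \<rightarrow> \<infinity>\<close>.
\<close>

lemma deg_mean_tendsto:
  assumes \<phi>: "\<And>d. 0 \<le> \<phi> d" "\<And>d. \<phi> d \<le> (real d)\<^sup>2"
  shows "tendsto_in_prob M (\<lambda>n \<omega>. deg_mean n \<phi> (G n \<omega>)) (\<integral>x. \<phi> (root_deg x) \<partial>\<Lambda>)"
  unfolding tendsto_in_prob_iff_whp[of "\<lambda>n. deg_mean n \<phi>"] whp_def
proof (intro allI impI)
  fix \<epsilon> :: real assume \<epsilon>: "\<epsilon> > 0"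
  define \<phi>' where "\<phi>' K d = (if (real d)\<^sup>2 > K then 0 else \<phi> d)" for K :: real and d
  have b: "bounded (range (\<phi>' K))" for K
  proof (rule boundedI[of _ "max K 0"], elim rangeE)
    fix y d assume "y = \<phi>' K d"
    then show "norm y \<le> max K 0" using \<phi>(1)[of d] \<phi>(2)[of d] by (auto simp: \<phi>'_def)
  qed
  have "((\<lambda>K. \<integral>x. \<phi>' K (root_deg x) \<partial>\<Lambda>) \<longlongrightarrow> (\<integral>x. \<phi> (root_deg x) \<partial>\<Lambda>)) at_top"
  proof (rule integral_dominated_convergence_at_top[OF _ _ integrable_root_deg_square])
    show "AE x in \<Lambda>. ((\<lambda>K. \<phi>' K (root_deg x)) \<longlongrightarrow> \<phi> (root_deg x)) at_top"
    proof (intro AE_I2 tendsto_eventually)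
      fix x show "eventually (\<lambda>K. \<phi>' K (root_deg x) = \<phi> (root_deg x)) at_top"
        using eventually_ge_at_top[of "(real (root_deg x))\<^sup>2"] by eventually_elim (simp add: \<phi>'_def)
    qed
    show "eventually (\<lambda>K. AE x in \<Lambda>. norm (\<phi>' K (root_deg x)) \<le> (real (root_deg x))\<^sup>2) at_top"
      using \<phi> by (auto simp: \<phi>'_def)
  qed (auto intro: measurable_root_deg[OF sets_eq])
  then have mean: "eventually (\<lambda>K. \<bar>(\<integral>x. \<phi>' K (root_deg x) \<partial>\<Lambda>) - (\<integral>x. \<phi> (root_deg x) \<partial>\<Lambda>)\<bar> < \<epsilon> / 3) at_top"
    using \<epsilon> by (auto dest!: tendstoD[of _ _ _ "\<epsilon> / 3"] simp: dist_real_def)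
  let ?p = "\<lambda>n. measure (M n) {\<omega> \<in> space (M n). \<not> \<bar>deg_mean n \<phi> (G n \<omega>) - (\<integral>x. \<phi> (root_deg x) \<partial>\<Lambda>)\<bar> \<le> \<epsilon>}"
  have "eventually (\<lambda>n. ?p n < \<eta>) sequentially" if \<eta>: "\<eta> > 0" for \<eta>
  proof -
    have "eventually (\<lambda>K. (\<forall>n\<ge>2. measure (M n) {\<omega> \<in> space (M n). deg_mean n (tail_square K) (G n \<omega>) > \<epsilon> / 3} \<le> \<eta> / 2)
       \<and> \<bar>(\<integral>x. \<phi>' K (root_deg x) \<partial>\<Lambda>) - (\<integral>x. \<phi> (root_deg x) \<partial>\<Lambda>)\<bar> < \<epsilon> / 3) at_top"
      using \<epsilon> \<eta> by (intro eventually_conj mean deg_mean_tail_square_small) auto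
    from eventually_happens[OF this] obtain K where
      K: "\<And>n. n \<ge> 2 \<Longrightarrow> measure (M n) {\<omega> \<in> space (M n). deg_mean n (tail_square K) (G n \<omega>) > \<epsilon> / 3} \<le> \<eta> / 2"
        "\<bar>(\<integral>x. \<phi>' K (root_deg x) \<partial>\<Lambda>) - (\<integral>x. \<phi> (root_deg x) \<partial>\<Lambda>)\<bar> < \<epsilon> / 3" by auto
    let ?E = "\<lambda>n H. \<bar>deg_mean n (\<phi>' K) H - (\<integral>x. \<phi>' K (root_deg x) \<partial>\<Lambda>)\<bar> \<le> \<epsilon> / 3"
    have "whp ?E"
      using \<epsilon> by (intro tendsto_in_prob_imp_whp[of "\<lambda>n. deg_mean n (\<phi>' K)"] deg_mean_bounded_tendsto[OF conv b]) simp
    then have "eventually (\<lambda>n. measure (M n) {\<omega> \<in> space (M n). \<not> ?E n (G n \<omega>)} < \<eta> / 2) sequentially"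
      unfolding whp_def by (rule order_tendstoD) (use \<eta> in simp)
    then show ?thesis using eventually_ge_at_top[of 2]
    proof eventually_elim
      case (elim n)
      have "deg_mean n (\<phi>' K) H \<le> deg_mean n \<phi> H" "deg_mean n \<phi> H \<le> deg_mean n (\<phi>' K) H + deg_mean n (tail_square K) H" for H
        unfolding deg_mean_add[symmetric] using \<phi> by (intro deg_mean_mono; simp add: \<phi>'_def tail_square_def)+
      note bounds = this
      have "\<bar>deg_mean n \<phi> H - (\<integral>x. \<phi> (root_deg x) \<partial>\<Lambda>)\<bar> \<le> \<epsilon>"
        if "deg_mean n (tail_square K) H \<le> \<epsilon> / 3" "?E n H" for H
        using bounds[of H] K(2) that by linarith
      then have "?p n \<le> measure (M n) {\<omega> \<in> space (M n). deg_mean n (tail_square K) (G n \<omega>) > \<epsilon> / 3}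
          + measure (M n) {\<omega> \<in> space (M n). \<not> ?E n (G n \<omega>)}"
        by (intro measure_G_union[OF elim(2),
              where P = "\<lambda>H. \<not> \<bar>deg_mean n \<phi> H - (\<integral>x. \<phi> (root_deg x) \<partial>\<Lambda>)\<bar> \<le> \<epsilon>"
                and Q = "\<lambda>H. deg_mean n (tail_square K) H > \<epsilon> / 3"
                and R = "\<lambda>H. \<not> ?E n H"]) (meson not_less)
      then show ?case using K(1)[OF elim(2)] elim(1) by linarith
    qed
  qed
  moreover have "eventually (\<lambda>n. a < ?p n) sequentially" if "a < 0" for a
    by (intro always_eventually allI less_le_trans[OF that measure_nonneg])
  ultimately show "?p \<longlonglongrightarrow> 0" by (rule order_tendstoI[rotated])
qed

subsection \<open>The stationary bias\<close>

text \<open>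
  The ratio is the mean degree under the stationary distribution. Its convergence needs a
  denominator bounded away from 0, which is where non-triviality of the limit enters:
  \<open>m\<^sub>1 \<ge> 1\<close>.
\<close>

lemma size_bias_ratio_tendsto:
  assumes nontriv: "AE x in \<Lambda>. nontrivial x" and "\<epsilon> > 0"
  defines "m\<^sub>1 \<equiv> \<integral>x. real (root_deg x) \<partial>\<Lambda>" and "m\<^sub>2 \<equiv> \<integral>x. (real (root_deg x))\<^sup>2 \<partial>\<Lambda>"
  shows "whp (\<lambda>n H. \<bar>deg_mean n (\<lambda>d. (real d)\<^sup>2) H / deg_mean n real H - m\<^sub>2 / m\<^sub>1\<bar> \<le> \<epsilon>)"
proof -
  interpret prob_space \<Lambda> by (rule prob)
  have le_square: "real d \<le> (real d)\<^sup>2" for d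
    by (metis le_square of_nat_le_iff of_nat_power power2_eq_square)
  have "integrable \<Lambda> (\<lambda>x. real (root_deg x))"
    using le_square by (intro Bochner_Integration.integrable_bound[OF integrable_root_deg_square] measurable_root_deg[OF sets_eq]) auto
  then have "(\<integral>x. 1 \<partial>\<Lambda>) \<le> m\<^sub>1" unfolding m\<^sub>1_def
    using nontriv by (intro integral_mono_AE) (auto dest!: nontrivial_imp_root_deg_pos simp: Suc_le_eq)
  then have m1: "m\<^sub>1 \<ge> 1" by (simp add: prob_space)
  define a where "a = m\<^sub>2 / m\<^sub>1"
  have a: "a \<ge> 0" "a * m\<^sub>1 = m\<^sub>2" using m1 by (auto simp: a_def m\<^sub>2_def)
  \<comment> \<open>For \<open>x\<close>, \<open>y\<close> within \<open>\<eta>\<close> of \<open>m\<^sub>2\<close>, \<open>m\<^sub>1\<close> one has \<open>y \<ge> 1 / 2\<close> and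
    \<open>\<bar>x - a y\<bar> = \<bar>(x - m\<^sub>2) - a (y - m\<^sub>1)\<bar> \<le> (1 + a) \<eta>\<close>.\<close>
  define \<eta> where "\<eta> = min (1 / 2) (\<epsilon> / (2 * (1 + a)))"
  have "\<eta> > 0" using a \<open>\<epsilon> > 0\<close> by (simp add: \<eta>_def)
  have "\<eta> \<le> \<epsilon> / (2 * (1 + a))" unfolding \<eta>_def by (rule min.cobounded2)
  then have "\<eta> * (2 * (1 + a)) \<le> \<epsilon>" using a by (simp add: pos_le_divide_eq)
  then have "(1 + a) * \<eta> \<le> \<epsilon> / 2" by (simp add: algebra_simps)
  moreover have "\<eta> \<le> 1 / 2" unfolding \<eta>_def by (rule min.cobounded1)
  ultimately have \<eta>: "\<eta> \<le> 1 / 2" "(1 + a) * \<eta> \<le> \<epsilon> / 2" by simp_all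
  have "whp (\<lambda>n H. \<bar>deg_mean n real H - m\<^sub>1\<bar> \<le> \<eta>)"
    unfolding m\<^sub>1_def using \<open>\<eta> > 0\<close> le_square
    by (intro tendsto_in_prob_imp_whp[of "\<lambda>n. deg_mean n real"] deg_mean_tendsto) auto
  moreover have "whp (\<lambda>n H. \<bar>deg_mean n (\<lambda>d. (real d)\<^sup>2) H - m\<^sub>2\<bar> \<le> \<eta>)"
    unfolding m\<^sub>2_def using \<open>\<eta> > 0\<close>
    by (intro tendsto_in_prob_imp_whp[of "\<lambda>n. deg_mean n (\<lambda>d. (real d)\<^sup>2)"] deg_mean_tendsto) auto
  ultimately have "whp (\<lambda>n H. \<bar>deg_mean n real H - m\<^sub>1\<bar> \<le> \<eta> \<and> \<bar>deg_mean n (\<lambda>d. (real d)\<^sup>2) H - m\<^sub>2\<bar> \<le> \<eta>)"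
    by (rule whp_conj)
  then show ?thesis
  proof (rule whp_mono)
    fix n H
    define x y where "x = deg_mean n (\<lambda>d. (real d)\<^sup>2) H" and "y = deg_mean n real H"
    assume "\<bar>deg_mean n real H - m\<^sub>1\<bar> \<le> \<eta> \<and> \<bar>deg_mean n (\<lambda>d. (real d)\<^sup>2) H - m\<^sub>2\<bar> \<le> \<eta>"
    then have xy: "\<bar>y - m\<^sub>1\<bar> \<le> \<eta>" "\<bar>x - m\<^sub>2\<bar> \<le> \<eta>" by (auto simp: x_def y_def)
    then have y: "y \<ge> 1 / 2" using m1 \<eta>(1) by linarith
    have "\<bar>x - a * y\<bar> = \<bar>(x - m\<^sub>2) - a * (y - m\<^sub>1)\<bar>" using a(2) by (simp add: algebra_simps)
    also have "\<dots> \<le> \<bar>x - m\<^sub>2\<bar> + a * \<bar>y - m\<^sub>1\<bar>" using a(1) by (metis abs_mult abs_of_nonneg abs_triangle_ineq4)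
    also have "\<dots> \<le> \<eta> + a * \<eta>" using xy a(1) by (intro add_mono mult_left_mono)
    also have "\<dots> \<le> \<epsilon> / 2" using \<eta>(2) by (simp add: algebra_simps)
    also have "\<dots> \<le> \<epsilon> * y" using y \<open>\<epsilon> > 0\<close> by simp
    finally have "\<bar>x - a * y\<bar> / y \<le> \<epsilon>" using y by (simp add: pos_divide_le_eq)
    moreover have "x / y - a = (x - a * y) / y" using y by (simp add: field_simps)
    ultimately have "\<bar>x / y - a\<bar> \<le> \<epsilon>" using y by simp
    then show "\<bar>deg_mean n (\<lambda>d. (real d)\<^sup>2) H / deg_mean n real H - m\<^sub>2 / m\<^sub>1\<bar> \<le> \<epsilon>"
      by (simp add: x_def y_def a_def)
  qed
qed

text \<open>
  With the random ratio replaced by its limit \<open>a\<close>, a test function becomes a bounded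
  function of the degree. The replacement costs little at degrees up to a large \<open>L\<close>, by uniform
  continuity on a compact interval, and at most \<open>2 B\<close> at the others, whose proportion is at most
  \<open>S\<^sub>2 / L\<close>, where \<open>S\<^sub>2\<close> is the average squared degree.
\<close>

lemma mu_st_weak_conv_in_prob:
  assumes nontriv: "AE x in \<Lambda>. nontrivial x"
  shows "weak_conv_in_prob M (\<lambda>n \<omega>. mu_st n (G n \<omega>)) (limit_law \<Lambda>)"
  unfolding weak_conv_in_prob_def
proof (intro allI impI)
  fix f :: "real \<Rightarrow> real"
  assume cont: "continuous_on UNIV f" and bdd: "bounded (range f)"
  then have fm [measurable]: "f \<in> borel_measurable borel" by (simp add: borel_measurable_continuous_onI)
  obtain B where "\<And>y. norm (f y) \<le> B" using bdd by (auto simp: bounded_iff)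
  then have B: "\<bar>f y\<bar> \<le> B" for y by simp
  have "B \<ge> 0" using B[of 0] by linarith
  define m\<^sub>1 where "m\<^sub>1 = (\<integral>x. real (root_deg x) \<partial>\<Lambda>)"
  define m\<^sub>2 where "m\<^sub>2 = (\<integral>x. (real (root_deg x))\<^sup>2 \<partial>\<Lambda>)"
  define a where "a = m\<^sub>2 / m\<^sub>1"
  define sq where "sq d = (real d)\<^sup>2" for d :: nat
  have "m\<^sub>2 \<ge> 0" by (simp add: m\<^sub>2_def)
  define A where "A n H = deg_mean n sq H / deg_mean n real H" for n H
  have ratio: "whp (\<lambda>n H. \<bar>A n H - a\<bar> \<le> \<epsilon>)" if "\<epsilon> > 0" for \<epsilon>
    using size_bias_ratio_tendsto[OF nontriv that] by (simp add: A_def a_def m\<^sub>1_def m\<^sub>2_def sq_def[abs_def])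
  have "A n H = (\<Sum>j\<in>{1..n}. sq (deg H j)) / (\<Sum>j\<in>{1..n}. real (deg H j))" for n H
    by (cases "n = 0") (simp_all add: A_def deg_mean_def)
  then have "bias_st n H i = A n H - deg H i" for n H i
    by (simp add: bias_st_def stat_dist_def sum_divide_distrib sq_def power2_eq_square)
  then have int: "(\<integral>x. f x \<partial>mu_st n H) = deg_mean n (\<lambda>d. f (A n H - d)) H" if "n \<ge> 2" for n H
    using that by (simp add: mu_st_def integral_empirical deg_mean_def)
  have lim: "(\<integral>x. f x \<partial>limit_law \<Lambda>) = (\<integral>x. f (a - real (root_deg x)) \<partial>\<Lambda>)"
    unfolding limit_law_def Let_def a_def m\<^sub>1_def m\<^sub>2_def
    by (intro integral_distr measurable_root_deg[OF sets_eq] fm)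
  show "tendsto_in_prob M (\<lambda>n \<omega>. \<integral>x. f x \<partial>mu_st n (G n \<omega>)) (\<integral>x. f x \<partial>limit_law \<Lambda>)"
    unfolding tendsto_in_prob_iff_whp[of "\<lambda>n H. \<integral>x. f x \<partial>mu_st n H"] lim
  proof (intro allI impI)
    fix \<epsilon> :: real assume \<epsilon>: "\<epsilon> > 0"
    \<comment> \<open>chosen such that \<open>2 B S\<^sub>2 / L \<le> \<epsilon> / 3\<close> as soon as \<open>S\<^sub>2 \<le> m\<^sub>2 + 1\<close>\<close>
    define L where "L = 6 * B * (m\<^sub>2 + 1) / \<epsilon> + 1"
    have L: "L \<ge> 1" using \<epsilon> \<open>B \<ge> 0\<close> \<open>m\<^sub>2 \<ge> 0\<close> by (simp add: L_def)
    have "6 * B * (m\<^sub>2 + 1) \<le> L * \<epsilon>" using \<epsilon> by (simp add: L_def field_simps)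
    then have BL: "2 * B / L * (m\<^sub>2 + 1) \<le> \<epsilon> / 3" using L by (simp add: field_simps)
    have "uniformly_continuous_on {a - L - 1..a + 1} f"
      by (intro compact_uniformly_continuous continuous_on_subset[OF cont]) auto
    then obtain \<eta>\<^sub>0 where \<eta>\<^sub>0: "\<eta>\<^sub>0 > 0"
      "\<And>x y. x \<in> {a - L - 1..a + 1} \<Longrightarrow> y \<in> {a - L - 1..a + 1} \<Longrightarrow> \<bar>x - y\<bar> < \<eta>\<^sub>0 \<Longrightarrow> \<bar>f x - f y\<bar> < \<epsilon> / 3"
      unfolding uniformly_continuous_on_def dist_real_def
      using divide_pos_pos[OF \<epsilon> zero_less_numeral, of "num.Bit1 num.One"] by (metis abs_minus_commute)
    define \<eta> where "\<eta> = min (\<eta>\<^sub>0 / 2) 1"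
    have \<eta>: "\<eta> > 0" "\<eta> < \<eta>\<^sub>0" "\<eta> \<le> 1" using \<eta>\<^sub>0(1) by (auto simp: \<eta>_def)
    have "bounded (range (\<lambda>d :: nat. f (a - d)))" by (rule bounded_subset[OF bdd]) auto
    then have "whp (\<lambda>n H. \<bar>deg_mean n (\<lambda>d. f (a - d)) H - (\<integral>x. f (a - real (root_deg x)) \<partial>\<Lambda>)\<bar> \<le> \<epsilon> / 3)"
      using \<epsilon> by (intro tendsto_in_prob_imp_whp[of "\<lambda>n. deg_mean n (\<lambda>d. f (a - d))"]
          deg_mean_bounded_tendsto[OF conv, of "\<lambda>d. f (a - d)"]) simp_all
    moreover have "whp (\<lambda>n H. \<bar>A n H - a\<bar> \<le> \<eta>)" using ratio \<eta>(1) by simp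
    moreover have "whp (\<lambda>n H. \<bar>deg_mean n sq H - m\<^sub>2\<bar> \<le> 1)"
      unfolding m\<^sub>2_def sq_def[symmetric]
      by (intro tendsto_in_prob_imp_whp[of "\<lambda>n. deg_mean n sq"] deg_mean_tendsto) (simp_all add: sq_def)
    ultimately have "whp (\<lambda>n H. \<bar>deg_mean n (\<lambda>d. f (a - d)) H - (\<integral>x. f (a - real (root_deg x)) \<partial>\<Lambda>)\<bar> \<le> \<epsilon> / 3
        \<and> \<bar>A n H - a\<bar> \<le> \<eta> \<and> \<bar>deg_mean n sq H - m\<^sub>2\<bar> \<le> 1)"
      by (intro whp_conj)
    then show "whp (\<lambda>n H. \<bar>(\<integral>x. f x \<partial>mu_st n H) - (\<integral>x. f (a - real (root_deg x)) \<partial>\<Lambda>)\<bar> \<le> \<epsilon>)"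
    proof (rule whp_mono)
      fix n H assume n: "n \<ge> 2"
        and *: "\<bar>deg_mean n (\<lambda>d. f (a - d)) H - (\<integral>x. f (a - real (root_deg x)) \<partial>\<Lambda>)\<bar> \<le> \<epsilon> / 3
          \<and> \<bar>A n H - a\<bar> \<le> \<eta> \<and> \<bar>deg_mean n sq H - m\<^sub>2\<bar> \<le> 1"
      have pointwise: "\<bar>f (A n H - d) - f (a - d)\<bar> \<le> \<epsilon> / 3 + 2 * B / L * sq d" for d :: nat
      proof (cases "real d \<le> L")
        case True
        have "\<bar>f (A n H - d) - f (a - d)\<bar> < \<epsilon> / 3"
          using True * \<eta> L by (intro \<eta>\<^sub>0(2)) auto
        moreover have "2 * B / L * sq d \<ge> 0" using \<open>B \<ge> 0\<close> L by (simp add: sq_def)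
        ultimately show ?thesis by linarith
      next
        case False
        then have "L * 1 \<le> real d * real d" using L by (intro mult_mono) auto
        then have "2 * B / L * L \<le> 2 * B / L * sq d"
          using \<open>B \<ge> 0\<close> L by (intro mult_left_mono) (auto simp: sq_def power2_eq_square)
        then have "2 * B \<le> 2 * B / L * sq d" using L by simp
        then show ?thesis using B[of "A n H - d"] B[of "a - d"] \<epsilon> by linarith
      qed
      have "\<bar>deg_mean n (\<lambda>d. f (A n H - d)) H - deg_mean n (\<lambda>d. f (a - d)) H\<bar>
          \<le> deg_mean n (\<lambda>d. \<bar>f (A n H - d) - f (a - d)\<bar>) H"
        unfolding deg_mean_diff[symmetric] by (rule deg_mean_abs)
      also have "\<dots> \<le> deg_mean n (\<lambda>d. \<epsilon> / 3 + 2 * B / L * sq d) H"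
        by (rule deg_mean_mono) (rule pointwise)
      also have "\<dots> = \<epsilon> / 3 + 2 * B / L * deg_mean n sq H"
        using n by (simp only: deg_mean_add deg_mean_cmult deg_mean_const[OF order_less_le_trans[OF zero_less_numeral n]])
      also have "2 * B / L * deg_mean n sq H \<le> 2 * B / L * (m\<^sub>2 + 1)"
        using * \<open>B \<ge> 0\<close> L by (intro mult_left_mono) auto
      finally have "\<bar>deg_mean n (\<lambda>d. f (A n H - d)) H - deg_mean n (\<lambda>d. f (a - d)) H\<bar> \<le> \<epsilon> / 3 + \<epsilon> / 3"
        using BL by linarith
      then show "\<bar>(\<integral>x. f x \<partial>mu_st n H) - (\<integral>x. f (a - real (root_deg x)) \<partial>\<Lambda>)\<bar> \<le> \<epsilon>"
        using * unfolding int[OF n] by linarith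
    qed
  qed
qed

end

end

end

theorem corollary4p3:
  fixes M :: "nat \<Rightarrow> 'w measure" and G :: "nat \<Rightarrow> 'w \<Rightarrow> mgraph" and \<delta> :: real
  assumes "0 < \<delta>" and "\<delta> < 1"
    and "\<And>n. n \<ge> 2 \<Longrightarrow> random_graph n (M n) (G n)"
    and "\<And>n. n \<ge> 2 \<Longrightarrow> AE \<omega> in M n. mg_connected (G n \<omega>)"
  shows "(\<forall>n\<ge>2. AE \<omega> in M n.
            weak_conv_m (\<lambda>k. mu_lazy \<delta> k n (G n \<omega>)) (mu_st n (G n \<omega>)))
    \<and> (\<forall>\<Lambda> :: rgraph measure.
         prob_space \<Lambda> \<and> sets \<Lambda> = sets borel \<and> (AE x in \<Lambda>. rooted_tree x \<and> nontrivial x) \<longrightarrow>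
         unif_integrable {(n, i). n \<ge> 2 \<and> i \<in> {1..n}} (\<lambda>(n, i). M n)
           (\<lambda>(n, i) \<omega>. (real (deg (G n \<omega>) i))\<^sup>2) \<longrightarrow>
         local_conv_in_prob M G \<Lambda> \<longrightarrow>
         weak_conv_in_prob M (\<lambda>n \<omega>. mu_st n (G n \<omega>)) (limit_law \<Lambda>))"
proof -
  interpret random_graph_sequence M G using assms(3) by unfold_locales
  have "AE \<omega> in M n. weak_conv_m (\<lambda>k. mu_lazy \<delta> k n (G n \<omega>)) (mu_st n (G n \<omega>))" if n: "n \<ge> 2" for n
    using assms(4)[OF n] AE_space
  proof eventually_elim
    case (elim \<omega>)
    then show ?case using n assms(1,2) G_in_graphs_on[OF n] by (intro mu_lazy_weak_conv) auto
  qed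
  moreover have "weak_conv_in_prob M (\<lambda>n \<omega>. mu_st n (G n \<omega>)) (limit_law \<Lambda>)"
    if "prob_space \<Lambda> \<and> sets \<Lambda> = sets borel \<and> (AE x in \<Lambda>. rooted_tree x \<and> nontrivial x)"
      "unif_integrable {(n, i). n \<ge> 2 \<and> i \<in> {1..n}} (\<lambda>(n, i). M n) (\<lambda>(n, i) \<omega>. (real (deg (G n \<omega>) i))\<^sup>2)"
      "local_conv_in_prob M G \<Lambda>" for \<Lambda> :: "rgraph measure"
    using that by (intro mu_st_weak_conv_in_prob) auto
  ultimately show ?thesis by blast
qed

end
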